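(* Let $X$ be a complete $\mathrm{CAT}(0)$ space, equip its boundary at infinity $\partial X$ with the angular metric $\angle$, and let $\mathcal G$ be the family of all subsets of $X$ of the form $c([0,\infty))$, where $c$ is a geodesic ray in $X$. Then the map \[ \partial X\to\mathcal G/{\sim},\quad \xi\mapsto[R_\xi], \] where $[R_\xi]$ is the equivalence class of $R_\xi$ with respect to linear equivalence, is one-to-one, onto, and bi-H\"older continuous: \[ \tfrac1\pi\angle(\xi,\zeta)\le\bigl(t([R_\xi],[R_\zeta])\bigr)^2\le\angle(\xi,\zeta) \] for all $\xi,\zeta\in\partial X$. Furthermore, $\mathcal G/{\sim}$ is a closed subset of $(\mathcal U/{\sim},t)$.
   Context: A geodesic ray in $(X,d)$ is a curve $c\colon[0,\infty)\to X$ with $d(c(x),c(y))=|x-y|$ for all $x,y\ge0$. $\partial X$ is the set of equivalence classes of geodesic rays, where $c,c'$ are equivalent if $d(c(x),c'(x))$ is bounded in $x$. For $p\in X$ and $\xi\in\partial X$ there is a unique geodesic ray in $\xi$ starting at $p$; $\angle_p(\xi,\zeta)$ is the (Alexandrov) angle at $p$ between the rays in $\xi$ and $\zeta$ starting at $p$, and $\angle(\xi,\zeta)=\sup_{p\in X}\angle_p(\xi,\zeta)$. Fix a reference point $o\in X$; $c_\xi$ is the unique ray in $\xi$ starting at $o$ and $R_\xi=c_\xi([0,\infty))$. With $B(x,r)$ closed balls, put $\alpha R+a=\bigcup_{x\in R}B(x,\alpha d(o,x)+a)$ for $R\subseteq X$, $\alpha,a\ge0$. For unbounded $R,S\subseteq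 X$ let $s^+(R,S)$ be the infimum of all $\alpha\ge0$ such that $S\subseteq\alpha R+a$ for some $a\ge0$; put $s(R,S)=\max\{s^+(R,S),s^+(S,R)\}$ and $t(R,S)=\sqrt{s(R,S)}$. $\mathcal U$ is the family of unbounded subsets of $X$; $R\sim S$ (linear equivalence) means $s(R,S)=0$, an equivalence relation, and $t$ induces a metric on $\mathcal U/{\sim}$. $\mathcal G/{\sim}\subseteq\mathcal U/{\sim}$ is the set of classes containing an element of $\mathcal G$. *)

theory Defs
  imports "HOL-Analysis.Analysis"
begin

section \<open>Geodesics and CAT(0) spaces\<close>

definition geodesic_segment :: "'a::metric_space \<Rightarrow> 'a \<Rightarrow> 'a set \<Rightarrow> bool" where
  "geodesic_segment p q S \<longleftrightarrow>
     (\<exists>c. c 0 = p \<and> c (dist p q) = q \<and>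
          (\<forall>s\<in>{0..dist p q}. \<forall>t\<in>{0..dist p q}. dist (c s) (c t) = \<bar>s - t\<bar>) \<and>
          S = c ` {0..dist p q})"

definition comparison_triangle ::
  "'a::metric_space \<Rightarrow> 'a \<Rightarrow> 'a \<Rightarrow> real^2 \<Rightarrow> real^2 \<Rightarrow> real^2 \<Rightarrow> bool" where
  "comparison_triangle p q r p' q' r' \<longleftrightarrow>
     dist p' q' = dist p q \<and> dist q' r' = dist q r \<and> dist r' p' = dist r p"

definition comparison_point ::
  "'a::metric_space \<Rightarrow> 'a set \<Rightarrow> real^2 \<Rightarrow> real^2 \<Rightarrow> 'a \<Rightarrow> real^2 \<Rightarrow> bool" where
  "comparison_point p S p' q' x x' \<longleftrightarrow>
     x \<in> S \<and> x' \<in> closed_segment p' q' \<and> dist p' x' = dist p x"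

definition CAT0 :: "'a::metric_space itself \<Rightarrow> bool" where
  "CAT0 (_ :: 'a itself) \<longleftrightarrow>
     (\<forall>p q :: 'a. \<exists>S. geodesic_segment p q S) \<and>
     (\<forall>(p::'a) q r S T U p' q' r'.
        geodesic_segment p q S \<and> geodesic_segment q r T \<and> geodesic_segment r p U \<and>
        comparison_triangle p q r p' q' r' \<longrightarrow>
        (let comparison = (\<lambda>x x'. comparison_point p S p' q' x x' \<or>
                                  comparison_point q T q' r' x x' \<or>
                                  comparison_point r U r' p' x x')
         in \<forall>x x' y y'. comparison x x' \<and> comparison y y' \<longrightarrow> dist x y \<le> dist x' y'))"


section \<open>The boundary at infinity and the angular metric\<close>

text \<open>
  A curve on \<open>[0, \<infinity>)\<close> is a function that is \<open>undefined\<close> on the negative reals; otherwise a ray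
  with a given starting point would not be unique in its class.
\<close>

definition geodesic_ray :: "(real \<Rightarrow> 'a::metric_space) \<Rightarrow> bool" where
  "geodesic_ray c \<longleftrightarrow>
     c \<in> extensional {0..} \<and> (\<forall>x\<ge>0. \<forall>y\<ge>0. dist (c x) (c y) = \<bar>x - y\<bar>)"

definition asymptotic :: "((real \<Rightarrow> 'a::metric_space) \<times> (real \<Rightarrow> 'a)) set" where
  "asymptotic = {(c, c'). geodesic_ray c \<and> geodesic_ray c' \<and>
                          bounded ((\<lambda>x. dist (c x) (c' x)) ` {0..})}"

definition boundary_at_infinity :: "(real \<Rightarrow> 'a::metric_space) set set" where
  "boundary_at_infinity = Collect geodesic_ray // asymptotic"

definition ray_from :: "'a::metric_space \<Rightarrow> (real \<Rightarrow> 'a) set \<Rightarrow> real \<Rightarrow> 'a" where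
  "ray_from p \<xi> = (THE c. c \<in> \<xi> \<and> c 0 = p)"

definition ray_image :: "'a::metric_space \<Rightarrow> (real \<Rightarrow> 'a) set \<Rightarrow> 'a set" where
  "ray_image b \<xi> = ray_from b \<xi> ` {0..}"

definition euclidean_angle :: "real^2 \<Rightarrow> real^2 \<Rightarrow> real^2 \<Rightarrow> real" where
  "euclidean_angle p q r = arccos (((q - p) \<bullet> (r - p)) / (norm (q - p) * norm (r - p)))"

definition comparison_angle :: "'a::metric_space \<Rightarrow> 'a \<Rightarrow> 'a \<Rightarrow> real" where
  "comparison_angle p q r =
     (THE \<theta>. \<exists>p' q' r'. comparison_triangle p q r p' q' r' \<and> \<theta> = euclidean_angle p' q' r')"

definition alexandrov_angle :: "(real \<Rightarrow> 'a::metric_space) \<Rightarrow> (real \<Rightarrow> 'a) \<Rightarrow> real" where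
  "alexandrov_angle c c' =
     real_of_ereal (Limsup (at_right 0 \<times>\<^sub>F at_right 0)
       (\<lambda>(s, t). ereal (comparison_angle (c 0) (c s) (c' t))))"

definition angle_at :: "'a::metric_space \<Rightarrow> (real \<Rightarrow> 'a) set \<Rightarrow> (real \<Rightarrow> 'a) set \<Rightarrow> real" where
  "angle_at p \<xi> \<zeta> = alexandrov_angle (ray_from p \<xi>) (ray_from p \<zeta>)"

definition angular_dist :: "(real \<Rightarrow> 'a::metric_space) set \<Rightarrow> (real \<Rightarrow> 'a) set \<Rightarrow> real" where
  "angular_dist \<xi> \<zeta> = (SUP p. angle_at p \<xi> \<zeta>)"

text \<open>The law of cosines; in particular comparison triangles exist.\<close>

lemma comparison_angle_eq:
  fixes p q r :: "'a::metric_space"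
  assumes "p \<noteq> q" "p \<noteq> r"
  shows "comparison_angle p q r =
    arccos (((dist p q)\<^sup>2 + (dist p r)\<^sup>2 - (dist q r)\<^sup>2) / (2 * dist p q * dist p r))"
proof -
  define a b c where "a = dist p q" and "b = dist p r" and "c = dist q r"
  define k where "k = (a\<^sup>2 + b\<^sup>2 - c\<^sup>2) / (2 * a * b)"
  have pos: "a > 0" "b > 0" using assms by (auto simp: a_def b_def)
  have tri: "c \<le> a + b" "a \<le> b + c" "b \<le> a + c" "c \<ge> 0"
    unfolding a_def b_def c_def
    by (metis dist_commute dist_triangle add.commute zero_le_dist)+
  have angle: "euclidean_angle p' q' r' = arccos k" if "comparison_triangle p q r p' q' r'" for p' q' r'
  proof -
    have "norm (q' - p') = a" "norm (r' - p') = b" "norm ((q' - p') - (r' - p')) = c"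
      using that dist_commute[of p r]
      by (auto simp: comparison_triangle_def a_def b_def c_def dist_norm norm_minus_commute)
    then show ?thesis
      unfolding euclidean_angle_def k_def by (simp add: dot_norm_neg mult.assoc)
  qed
  have "c\<^sup>2 \<le> (a + b)\<^sup>2" using tri by (intro power_mono) auto
  then have "-1 \<le> k" using pos by (simp add: k_def field_simps power2_eq_square)
  have "(a - b)\<^sup>2 \<le> c\<^sup>2" using tri by (intro abs_le_square_iff[THEN iffD1]) auto
  then have "k \<le> 1" using pos by (simp add: k_def field_simps power2_eq_square)
  define \<theta> where "\<theta> = arccos k"
  have cos: "cos \<theta> = k" using \<open>-1 \<le> k\<close> \<open>k \<le> 1\<close> by (simp add: \<theta>_def)
  define q' r' :: "real^2" where "q' = vector [a, 0]" and "r' = vector [b * cos \<theta>, b * sin \<theta>]"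
  have nq: "norm q' = a" using pos by (simp add: q'_def norm_vec_def L2_set_def UNIV_2)
  have nr: "norm r' = b"
    using pos by (simp add: r'_def norm_vec_def L2_set_def UNIV_2 power_mult_distrib flip: distrib_left)
  have "q' \<bullet> r' = a * b * k" by (simp add: q'_def r'_def inner_vec_def UNIV_2 cos)
  then have "(norm (q' - r'))\<^sup>2 = a\<^sup>2 + b\<^sup>2 - 2 * (a * b * k)"
    using dot_norm_neg[of q' r'] nq nr by simp
  also have "\<dots> = c\<^sup>2" using pos by (simp add: k_def field_simps)
  finally have "norm (q' - r') = c" using tri by simp
  then have "comparison_triangle p q r 0 q' r'"
    using nq nr by (simp add: comparison_triangle_def a_def b_def c_def dist_norm dist_commute)
  then have "comparison_angle p q r = arccos k"
    unfolding comparison_angle_def using angle by (intro the_equality) metis+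
  then show ?thesis by (simp add: k_def a_def b_def c_def)
qed


section \<open>Linear equivalence of unbounded sets\<close>

text \<open>Below, \<open>b\<close> is the reference point.\<close>

definition linear_nbhd :: "'a::metric_space \<Rightarrow> real \<Rightarrow> 'a set \<Rightarrow> real \<Rightarrow> 'a set" where
  "linear_nbhd b \<alpha> R a = (\<Union>x\<in>R. cball x (\<alpha> * dist b x + a))"

definition s_plus :: "'a::metric_space \<Rightarrow> 'a set \<Rightarrow> 'a set \<Rightarrow> real" where
  "s_plus b R S = Inf {\<alpha>. \<alpha> \<ge> 0 \<and> (\<exists>a\<ge>0. S \<subseteq> linear_nbhd b \<alpha> R a)}"

definition s_dist :: "'a::metric_space \<Rightarrow> 'a set \<Rightarrow> 'a set \<Rightarrow> real" where
  "s_dist b R S = max (s_plus b R S) (s_plus b S R)"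

definition t_dist :: "'a::metric_space \<Rightarrow> 'a set \<Rightarrow> 'a set \<Rightarrow> real" where
  "t_dist b R S = sqrt (s_dist b R S)"

definition unbounded_sets :: "'a::metric_space set set" where
  "unbounded_sets = {R. \<not> bounded R}"

definition linear_equiv :: "'a::metric_space \<Rightarrow> ('a set \<times> 'a set) set" where
  "linear_equiv b = {(R, S). R \<in> unbounded_sets \<and> S \<in> unbounded_sets \<and> s_dist b R S = 0}"

definition linear_class :: "'a::metric_space \<Rightarrow> 'a set \<Rightarrow> 'a set set" where
  "linear_class b R = linear_equiv b `` {R}"

definition linear_classes :: "'a::metric_space \<Rightarrow> 'a set set set" where
  "linear_classes b = unbounded_sets // linear_equiv b"

text \<open>
  The metric induced by \<open>t_dist\<close> on classes. It is extended by \<open>0\<close> because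
  \<^locale>\<open>Metric_space\<close> requires non-negativity also outside the carrier.
\<close>

definition class_dist :: "'a::metric_space \<Rightarrow> 'a set set \<Rightarrow> 'a set set \<Rightarrow> real" where
  "class_dist b A B =
     (if A \<in> linear_classes b \<and> B \<in> linear_classes b
      then THE d. \<forall>R\<in>A. \<forall>S\<in>B. d = t_dist b R S else 0)"

definition rays :: "'a::metric_space set set" where
  "rays = {c ` {0..} | c. geodesic_ray c}"

definition ray_classes :: "'a::metric_space \<Rightarrow> 'a set set set" where
  "ray_classes b = {A \<in> linear_classes b. A \<inter> rays \<noteq> {}}"

lemma s_plus_set_upper:
  assumes "R \<in> unbounded_sets" "\<epsilon> > 0"
  shows "\<exists>a\<ge>0. S \<subseteq> linear_nbhd b (1 + \<epsilon>) R a"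
proof -
  have "\<exists>x\<in>R. y \<in> cball x ((1 + \<epsilon>) * dist b x + 0)" for y
  proof -
    have "\<exists>x\<in>R. dist b x > dist b y / \<epsilon>"
      using assms(1) unfolding unbounded_sets_def bounded_def mem_Collect_eq by (meson not_le)
    then obtain x where x: "x \<in> R" "dist b y / \<epsilon> < dist b x" by blast
    have "dist b y \<le> \<epsilon> * dist b x" using x(2) assms(2) by (simp add: field_simps)
    moreover have "dist x y \<le> dist b x + dist b y" by (metis dist_commute dist_triangle)
    ultimately show ?thesis using x(1) by (intro bexI[of _ x]) (auto simp: algebra_simps)
  qed
  then show ?thesis unfolding linear_nbhd_def by (intro exI[of _ 0]) auto
qed

lemma s_plus_le:
  assumes "\<alpha> \<ge> 0" "a \<ge> 0" "S \<subseteq> linear_nbhd b \<alpha> R a"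
  shows "s_plus b R S \<le> \<alpha>"
  unfolding s_plus_def by (intro cInf_lower bdd_belowI[of _ 0]) (use assms in auto)

lemma s_plus_ge_0: "R \<in> unbounded_sets \<Longrightarrow> s_plus b R S \<ge> 0"
  unfolding s_plus_def
  using s_plus_set_upper[of R 1 S b] by (intro cInf_greatest) fastforce+

lemma s_plus_le_1:
  assumes "R \<in> unbounded_sets"
  shows "s_plus b R S \<le> 1"
proof (rule field_le_epsilon)
  fix e :: real assume "e > 0"
  with s_plus_set_upper[OF assms this, of S b] obtain a
    where "a \<ge> 0" "S \<subseteq> linear_nbhd b (1 + e) R a" by blast
  with \<open>e > 0\<close> show "s_plus b R S \<le> 1 + e" by (intro s_plus_le) auto
qed

lemma s_plus_less:
  assumes "R \<in> unbounded_sets" "s_plus b R S < \<beta>"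
  obtains \<alpha> a where "0 \<le> \<alpha>" "\<alpha> < \<beta>" "a \<ge> 0" "S \<subseteq> linear_nbhd b \<alpha> R a"
proof -
  let ?A = "{\<alpha>. \<alpha> \<ge> 0 \<and> (\<exists>a\<ge>0. S \<subseteq> linear_nbhd b \<alpha> R a)}"
  have "?A \<noteq> {}" using s_plus_set_upper[OF assms(1), of 1 S b] by fastforce
  from cInf_lessD[OF this, of \<beta>] assms(2) show ?thesis unfolding s_plus_def using that by auto
qed

lemma s_plus_triangle:
  assumes "R \<in> unbounded_sets" "S \<in> unbounded_sets"
  shows "s_plus b R T \<le> s_plus b R S + s_plus b S T + s_plus b R S * s_plus b S T"
proof -
  let ?u = "s_plus b R S" and ?v = "s_plus b S T"
  have key: "s_plus b R T + 1 \<le> (1 + ?u + e) * (1 + ?v + e)" if e: "e > 0" for e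
  proof -
    obtain \<alpha> a where \<alpha>: "0 \<le> \<alpha>" "\<alpha> < ?u + e" "a \<ge> 0" "S \<subseteq> linear_nbhd b \<alpha> R a"
      by (rule s_plus_less[OF assms(1), of b S "?u + e"]) (use e in auto)
    obtain \<beta> d where \<beta>: "0 \<le> \<beta>" "\<beta> < ?v + e" "d \<ge> 0" "T \<subseteq> linear_nbhd b \<beta> S d"
      by (rule s_plus_less[OF assms(2), of b T "?v + e"]) (use e in auto)
    have "T \<subseteq> linear_nbhd b (\<alpha> + \<beta> + \<alpha> * \<beta>) R (a + \<beta> * a + d)"
    proof
      fix z assume "z \<in> T"
      with \<beta>(4) obtain y where y: "y \<in> S" "dist y z \<le> \<beta> * dist b y + d"
        by (auto simp: linear_nbhd_def)
      with \<alpha>(4) obtain x where x: "x \<in> R" "dist x y \<le> \<alpha> * dist b x + a"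
        by (auto simp: linear_nbhd_def)
      have "dist b y \<le> dist b x + dist x y" by (rule dist_triangle)
      also have "\<dots> \<le> (1 + \<alpha>) * dist b x + a" using x by (simp add: algebra_simps)
      finally have "\<beta> * dist b y \<le> \<beta> * ((1 + \<alpha>) * dist b x + a)" using \<beta>(1) by (rule mult_left_mono)
      moreover have "dist x z \<le> dist x y + dist y z" by (rule dist_triangle)
      ultimately have "dist x z \<le> (\<alpha> + \<beta> + \<alpha> * \<beta>) * dist b x + (a + \<beta> * a + d)"
        using x y by (simp add: algebra_simps)
      with x show "z \<in> linear_nbhd b (\<alpha> + \<beta> + \<alpha> * \<beta>) R (a + \<beta> * a + d)"
        by (auto simp: linear_nbhd_def)
    qed
    then have "s_plus b R T \<le> \<alpha> + \<beta> + \<alpha> * \<beta>" by (intro s_plus_le) (use \<alpha> \<beta> in auto)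
    then have "s_plus b R T + 1 \<le> (1 + \<alpha>) * (1 + \<beta>)" by (simp add: algebra_simps)
    also have "\<dots> \<le> (1 + ?u + e) * (1 + ?v + e)" by (intro mult_mono) (use \<alpha> \<beta> in auto)
    finally show ?thesis .
  qed
  have "((\<lambda>e. (1 + ?u + e) * (1 + ?v + e)) \<longlongrightarrow> (1 + ?u + 0) * (1 + ?v + 0)) (at_right 0)"
    by (intro tendsto_intros)
  moreover have "eventually (\<lambda>e. s_plus b R T + 1 \<le> (1 + ?u + e) * (1 + ?v + e)) (at_right 0)"
    by (rule eventually_mono[OF eventually_at_right_less]) (rule key)
  ultimately have "s_plus b R T + 1 \<le> (1 + ?u + 0) * (1 + ?v + 0)"
    by (intro tendsto_lowerbound) auto
  then show ?thesis by (simp add: algebra_simps)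
qed

lemma s_dist_commute: "s_dist b R S = s_dist b S R"
  by (simp add: s_dist_def max.commute)

lemma t_dist_commute: "t_dist b R S = t_dist b S R"
  by (simp add: t_dist_def s_dist_commute)

lemma s_dist_bounds:
  assumes "R \<in> unbounded_sets" "S \<in> unbounded_sets"
  shows "s_dist b R S \<ge> 0" "s_dist b R S \<le> 1"
  using assms by (auto simp: s_dist_def s_plus_ge_0 s_plus_le_1 le_max_iff_disj)

lemma t_dist_triangle:
  assumes "R \<in> unbounded_sets" "S \<in> unbounded_sets" "T \<in> unbounded_sets"
  shows "t_dist b R T \<le> t_dist b R S + t_dist b S T"
proof -
  let ?u = "s_dist b R S" and ?v = "s_dist b S T"
  note bnd = s_dist_bounds[OF assms(1,2), of b] s_dist_bounds[OF assms(2,3), of b]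
  have mono: "x + y + x * y \<le> ?u + ?v + ?u * ?v" if "0 \<le> x" "x \<le> ?u" "0 \<le> y" "y \<le> ?v" for x y
    using that by (intro add_mono mult_mono) auto
  have "s_plus b R T \<le> ?u + ?v + ?u * ?v"
    by (rule order_trans[OF s_plus_triangle[OF assms(1,2)] mono])
      (use assms in \<open>auto simp: s_plus_ge_0 s_dist_def\<close>)
  moreover have "s_plus b T R \<le> s_plus b S R + s_plus b T S + s_plus b S R * s_plus b T S"
    using s_plus_triangle[OF assms(3,2), of b R] by (simp add: algebra_simps)
  then have "s_plus b T R \<le> ?u + ?v + ?u * ?v"
    by (rule order_trans[OF _ mono])
      (use assms in \<open>auto simp: s_plus_ge_0 s_dist_def\<close>)
  ultimately have "s_dist b R T \<le> ?u + ?v + ?u * ?v" by (simp add: s_dist_def)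
  also have "\<dots> \<le> (sqrt ?u + sqrt ?v)\<^sup>2"
  proof -
    have 1: "sqrt ?u * sqrt ?v \<le> 1 * 1" using bnd by (intro mult_mono) auto
    have "?u * ?v = (sqrt ?u * sqrt ?v) * (sqrt ?u * sqrt ?v)"
      using bnd by (simp add: mult.assoc mult.left_commute)
    also have "\<dots> \<le> 1 * (sqrt ?u * sqrt ?v)" using 1 bnd by (intro mult_right_mono) auto
    also have "\<dots> \<le> 2 * (sqrt ?u * sqrt ?v)" using bnd by simp
    finally show ?thesis using bnd by (simp add: power2_sum)
  qed
  finally have "s_dist b R T \<le> (sqrt ?u + sqrt ?v)\<^sup>2" .
  then show ?thesis unfolding t_dist_def using bnd by (intro real_le_lsqrt) auto
qed

lemma equiv_linear_equiv: "equiv unbounded_sets (linear_equiv b)"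
proof (rule equivI)
  show "refl_on unbounded_sets (linear_equiv b)"
  proof (rule refl_onI)
    fix R :: "'a set" assume R: "R \<in> unbounded_sets"
    have "s_plus b R R \<le> 0" by (rule s_plus_le[of 0 0]) (auto simp: linear_nbhd_def)
    with s_plus_ge_0[OF R, of b R] have "s_plus b R R = 0" by linarith
    with R show "(R, R) \<in> linear_equiv b" by (auto simp: linear_equiv_def s_dist_def)
  qed
  show "sym (linear_equiv b)" by (auto simp: sym_def linear_equiv_def s_dist_commute)
  show "trans (linear_equiv b)"
  proof (rule transI)
    fix R S T assume *: "(R, S) \<in> linear_equiv b" "(S, T) \<in> linear_equiv b"
    then have u: "R \<in> unbounded_sets" "S \<in> unbounded_sets" "T \<in> unbounded_sets"
      by (auto simp: linear_equiv_def)
    have "t_dist b R T \<le> 0"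
      using t_dist_triangle[OF u, of b] * by (auto simp: linear_equiv_def t_dist_def)
    with s_dist_bounds[OF u(1,3), of b] u show "(R, T) \<in> linear_equiv b"
      by (auto simp: linear_equiv_def t_dist_def)
  qed
qed (auto simp: linear_equiv_def)

lemma class_dist_eq:
  assumes "R \<in> unbounded_sets" "S \<in> unbounded_sets"
  shows "class_dist b (linear_class b R) (linear_class b S) = t_dist b R S"
proof -
  have self: "R \<in> linear_class b R" "S \<in> linear_class b S"
    using assms equiv_class_self[OF equiv_linear_equiv] by (auto simp: linear_class_def)
  have "t_dist b R S = t_dist b R' S'"
    if "R' \<in> linear_class b R" "S' \<in> linear_class b S" for R' S'
  proof -
    have u: "R' \<in> unbounded_sets" "S' \<in> unbounded_sets"
      and 0: "t_dist b R R' = 0" "t_dist b S S' = 0"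
      using that by (auto simp: linear_class_def linear_equiv_def t_dist_def)
    show ?thesis
      using t_dist_triangle[OF assms(1) u(1) assms(2), of b] t_dist_triangle[OF u(1) u(2) assms(2), of b]
        t_dist_triangle[OF u(1) assms(1) u(2), of b] t_dist_triangle[OF assms(1) assms(2) u(2), of b]
        0 t_dist_commute[of b R R'] t_dist_commute[of b S S'] by linarith
  qed
  then have "(THE d. \<forall>R'\<in>linear_class b R. \<forall>S'\<in>linear_class b S. d = t_dist b R' S') = t_dist b R S"
    by (intro the_equality ballI) (blast intro: self)+
  moreover have "linear_class b R \<in> linear_classes b" "linear_class b S \<in> linear_classes b"
    unfolding linear_classes_def linear_class_def using assms by (auto intro: quotientI)
  ultimately show ?thesis by (simp only: class_dist_def simp_thms if_True)
qed

lemma Metric_space_linear_classes: "Metric_space (linear_classes b) (class_dist b)"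
proof
  have rep: "\<exists>R\<in>unbounded_sets. A = linear_class b R" if "A \<in> linear_classes b" for A
    using that by (auto simp: linear_classes_def linear_class_def elim!: quotientE)
  fix A B C :: "'a set set"
  show "0 \<le> class_dist b A B"
  proof (cases "A \<in> linear_classes b \<and> B \<in> linear_classes b")
    case True
    then obtain R S where "R \<in> unbounded_sets" "S \<in> unbounded_sets"
      "A = linear_class b R" "B = linear_class b S" using rep by metis
    then show ?thesis by (simp add: class_dist_eq t_dist_def s_dist_bounds)
  qed (auto simp: class_dist_def)
  show "class_dist b A B = class_dist b B A"
  proof -
    have "(\<forall>R\<in>A. \<forall>S\<in>B. d = t_dist b R S) \<longleftrightarrow> (\<forall>S\<in>B. \<forall>R\<in>A. d = t_dist b S R)" for d
      using t_dist_commute by metis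
    then show ?thesis unfolding class_dist_def by (simp only: conj_commute)
  qed
  assume A: "A \<in> linear_classes b" and B: "B \<in> linear_classes b"
  obtain R S where RS: "R \<in> unbounded_sets" "S \<in> unbounded_sets"
      "A = linear_class b R" "B = linear_class b S" using rep A B by metis
  have "A = B \<longleftrightarrow> (R, S) \<in> linear_equiv b"
    using eq_equiv_class_iff[OF equiv_linear_equiv RS(1,2)] RS by (simp add: linear_class_def)
  then show "class_dist b A B = 0 \<longleftrightarrow> A = B"
    using RS by (simp add: class_dist_eq t_dist_def linear_equiv_def)
  assume "C \<in> linear_classes b"
  then obtain T where "T \<in> unbounded_sets" "C = linear_class b T" using rep by metis
  then show "class_dist b A C \<le> class_dist b A B + class_dist b B C"
    using RS by (simp add: class_dist_eq t_dist_triangle)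
qed

end

theory Submission
  imports Defs
begin

text \<open>
  Fix the base point \<open>b\<close> and two rays \<open>c\<close>, \<open>c'\<close> from \<open>b\<close>. In a CAT(0) space the Euclidean
  comparison angle at \<open>b\<close> of the points \<open>c s\<close>, \<open>c' t\<close> increases with \<open>s\<close> and \<open>t\<close>; equivalently
  its cosine, written \<open>comparison_cos\<close> below, decreases
  (\<open>comparison_cos_rays_antimono\<close>). Let \<open>\<theta>\<close> be its limit. On the diagonal \<open>s = t\<close> the triangles
  are isosceles, so \<open>2 sin (\<theta>/2)\<close> is the limit \<open>L\<close> of \<open>dist (c t) (c' t) / t\<close>, which is also the
  supremum. Everything follows from comparing the two metrics with \<open>\<theta>\<close>.

  The angular distance equals \<open>\<theta>\<close> (\<open>angular_dist_eq_limit_angle\<close>). It is at most \<open>\<theta>\<close> because the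
  Alexandrov angle at any point \<open>p\<close> is bounded by the limiting comparison angle at \<open>p\<close>, and \<open>L\<close> does
  not change when both rays are replaced by asymptotic ones from \<open>p\<close>. For the other inequality,
  look at \<open>p = c T\<close>. In the triangle with vertices \<open>b\<close>, \<open>p\<close> and a far point of \<open>c'\<close>, the angle at
  the far point is nearly zero, so the comparison angles at \<open>b\<close> and at \<open>p\<close> nearly add up to \<open>\<pi>\<close>; hence the
  angle at \<open>p\<close> between the forward ray \<open>c\<close> and the ray towards \<open>c'\<close> is at least the comparison
  angle at \<open>b\<close> of \<open>c T\<close>, \<open>c' T\<close> (\<open>comparison_cos_along_ray\<close>), and this tends to \<open>\<theta>\<close>.

  The linear distance \<open>s_dist\<close> of the two rays, the square of the metric on classes, is at most \<open>L\<close>, since \<open>c t\<close> and \<open>c' t\<close> are at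
  distance at most \<open>L * t\<close>, and \<open>L = 2 sin (\<theta>/2) \<le> \<theta>\<close>. Conversely, if \<open>c'\<close> stays in a linear
  neighbourhood of \<open>c\<close> with slope below \<open>\<beta> < 1\<close>, then far-out comparison triangles force \<open>sin \<theta> \<le> \<beta>\<close> with
  \<open>\<theta> \<le> \<pi>/2\<close> (\<open>limit_cos_ge_of_linear_nbhd\<close>), and \<open>\<theta> \<le> \<pi> sin \<theta>\<close> there; this gives
  \<open>\<theta> \<le> \<pi> * s_dist\<close>.

  In particular \<open>dist (c t) (c' t) \<le> \<pi> * s_dist * t\<close>. So distinct boundary points have inequivalent
  rays, and a sequence of rays from \<open>b\<close> that is Cauchy for \<open>s_dist\<close> converges pointwise, with linearly
  controlled error, to a ray (\<open>Cauchy_rays_converge\<close>), which makes the set of ray classes closed.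
  Surjectivity holds because an asymptotic ray from \<open>b\<close> stays at bounded distance from the given
  ray.
\<close>

section \<open>Stewart's inequality in CAT(0) spaces\<close>

text \<open>
  The side lengths satisfy the triangle inequalities, so a triangle with one vertex at the origin
  and one on the first axis can be written down; the third vertex comes from the law of cosines.
\<close>

lemma comparison_triangle_exists:
  fixes p q r :: "'a::metric_space"
  obtains p' q' r' where "comparison_triangle p q r p' q' r'"
proof (cases "p = q")
  case True
  have "comparison_triangle p q r 0 0 (vector [dist p r, 0])"
    using True by (simp add: comparison_triangle_def norm_vec_def L2_set_def UNIV_2 dist_commute)
  then show ?thesis by (rule that)
next
  case False
  define a b d where "a = dist p q" and "b = dist p r" and "d = dist q r"
  have a: "a > 0" using False by (simp add: a_def)
  have tri: "d \<le> a + b" "a \<le> b + d" "b \<le> a + d" "b \<ge> 0" "d \<ge> 0"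
    unfolding a_def b_def d_def by (metis dist_commute dist_triangle add.commute zero_le_dist)+
  define x where "x = (a\<^sup>2 + b\<^sup>2 - d\<^sup>2) / (2 * a)"
  have x: "2 * a * x = a\<^sup>2 + b\<^sup>2 - d\<^sup>2" using a by (simp add: x_def)
  have "d\<^sup>2 \<le> (a + b)\<^sup>2" "(a - b)\<^sup>2 \<le> d\<^sup>2"
    using tri a by (intro power_mono, auto intro!: abs_le_square_iff[THEN iffD1])
  then have "2 * a * x \<ge> 2 * a * (- b)" "2 * a * x \<le> 2 * a * b"
    unfolding x by (auto simp: power2_eq_square algebra_simps)
  then have "- b \<le> x" "x \<le> b" using a mult_le_cancel_left_pos[of "2 * a" "- b" x] mult_le_cancel_left_pos[of "2 * a" x b]
    by linarith+
  then have xb: "x\<^sup>2 \<le> b\<^sup>2" using abs_le_square_iff[of x b] by auto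
  define q' r' :: "real^2" where "q' = vector [a, 0]" and "r' = vector [x, sqrt (b\<^sup>2 - x\<^sup>2)]"
  have "norm q' = a" using a by (simp add: q'_def norm_vec_def L2_set_def UNIV_2)
  moreover have nr: "norm r' = b"
    using tri xb by (simp add: r'_def norm_vec_def L2_set_def UNIV_2)
  moreover have "norm (q' - r') = d"
  proof -
    have "(a - x)\<^sup>2 + (b\<^sup>2 - x\<^sup>2) = d\<^sup>2" using x by (simp add: power2_eq_square algebra_simps)
    then show ?thesis
      using tri xb by (simp add: q'_def r'_def norm_vec_def L2_set_def UNIV_2)
  qed
  ultimately have "comparison_triangle p q r 0 q' r'"
    by (simp add: comparison_triangle_def a_def b_def d_def dist_norm dist_commute)
  then show ?thesis by (rule that)
qed

lemma CAT0_geodesic: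
  fixes p q :: "'a::metric_space"
  assumes "CAT0 TYPE('a)"
  obtains c where "c 0 = p" "c (dist p q) = q"
    "\<And>s t. \<lbrakk>0 \<le> s; s \<le> dist p q; 0 \<le> t; t \<le> dist p q\<rbrakk> \<Longrightarrow> dist (c s) (c t) = \<bar>s - t\<bar>"
proof -
  obtain S where "geodesic_segment p q S" using assms unfolding CAT0_def by metis
  then obtain c where "c 0 = p" "c (dist p q) = q"
    "\<forall>s\<in>{0..dist p q}. \<forall>t\<in>{0..dist p q}. dist (c s) (c t) = \<bar>s - t\<bar>"
    unfolding geodesic_segment_def by blast
  then show ?thesis by (intro that[of c]) auto
qed

text \<open>
  Geodesics from \<open>q\<close> to \<open>x\<close> and from \<open>x\<close> to \<open>r\<close> join to a geodesic, because a shortcut across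
  \<open>x\<close> would make the distance from \<open>q\<close> to \<open>r\<close> too short. This lets later arguments speak about
  metric betweenness of points instead of segments.
\<close>

lemma geodesic_segment_through:
  fixes q x r :: "'a::metric_space"
  assumes "CAT0 TYPE('a)" "dist q x + dist x r = dist q r"
  obtains T where "geodesic_segment q r T" "x \<in> T"
proof -
  obtain c where c: "c 0 = q" "c (dist q x) = x"
    "\<And>s t. \<lbrakk>0 \<le> s; s \<le> dist q x; 0 \<le> t; t \<le> dist q x\<rbrakk> \<Longrightarrow> dist (c s) (c t) = \<bar>s - t\<bar>"
    using CAT0_geodesic[OF assms(1)] by metis
  obtain e where e: "e 0 = x" "e (dist x r) = r"
    "\<And>s t. \<lbrakk>0 \<le> s; s \<le> dist x r; 0 \<le> t; t \<le> dist x r\<rbrakk> \<Longrightarrow> dist (e s) (e t) = \<bar>s - t\<bar>"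
    using CAT0_geodesic[OF assms(1)] by metis
  define f where "f t = (if t \<le> dist q x then c t else e (t - dist q x))" for t
  have cross: "dist (f s) (f t) = t - s" if "0 \<le> s" "s \<le> dist q x" "dist q x < t" "t \<le> dist q r" for s t
  proof -
    have "dist (f s) x = dist q x - s" "dist q (f s) = s"
      using that c(3)[of s "dist q x"] c(3)[of 0 s] c(1,2) by (auto simp: f_def)
    moreover have "dist x (f t) = t - dist q x" "dist (f t) r = dist q r - t"
      using that e(3)[of 0 "t - dist q x"] e(3)[of "t - dist q x" "dist x r"] e(1,2) assms(2)
      by (auto simp: f_def)
    moreover have "dist q r \<le> dist q (f s) + dist (f s) (f t) + dist (f t) r"
      by (meson dist_triangle add_right_mono order_trans)
    ultimately show ?thesis using dist_triangle[of "f s" "f t" x] by linarith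
  qed
  have iso: "dist (f s) (f t) = \<bar>s - t\<bar>"
    if "0 \<le> s" "s \<le> dist q r" "0 \<le> t" "t \<le> dist q r" for s t
  proof -
    consider "s \<le> dist q x" "t \<le> dist q x" | "s > dist q x" "t > dist q x"
      | "s \<le> dist q x" "t > dist q x" | "s > dist q x" "t \<le> dist q x" by linarith
    then show ?thesis
    proof cases
      case 1 then show ?thesis using that c(3) by (simp add: f_def)
    next
      case 2 then show ?thesis using that e(3) assms(2) by (simp add: f_def)
    next
      case 3 then show ?thesis using that cross by simp
    next
      case 4 then show ?thesis using that cross[of t s] by (simp add: dist_commute)
    qed
  qed
  have ends: "f 0 = q" "f (dist q x) = x" by (simp_all add: f_def c)
  have "f (dist q r) = r"
  proof (cases "x = r")
    case False
    then have "\<not> dist q r \<le> dist q x" using assms(2) zero_less_dist_iff[of x r] by linarith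
    moreover have "dist q r - dist q x = dist x r" using assms(2) by linarith
    ultimately show ?thesis using e(2) by (simp add: f_def)
  qed (use ends in simp)
  then have "geodesic_segment q r (f ` {0..dist q r})"
    unfolding geodesic_segment_def using ends iso by (intro exI[of _ f]) auto
  moreover have "x \<in> f ` {0..dist q r}"
  proof (rule image_eqI)
    show "x = f (dist q x)" by (simp add: ends)
    show "dist q x \<in> {0..dist q r}" using assms(2) zero_le_dist[of x r] zero_le_dist[of q x] unfolding atLeastAtMost_iff by linarith
  qed
  ultimately show ?thesis by (rule that)
qed

text \<open>
  In the plane Stewart's theorem is this statement with equality; the comparison point of \<open>x\<close> is at
  least as far from the opposite vertex as \<open>x\<close> is. All comparisons below go through this
  inequality. It is free of division and so includes degenerate triangles.
\<close>

lemma CAT0_stewart: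
  fixes p q r x :: "'a::metric_space"
  assumes "CAT0 TYPE('a)" "dist q x + dist x r = dist q r"
  shows "dist q r * (dist p x)\<^sup>2
    \<le> dist x r * (dist p q)\<^sup>2 + dist q x * (dist p r)\<^sup>2 - dist q x * dist x r * dist q r"
proof (cases "q = r")
  case True
  then have "dist q x = 0" "dist x r = 0"
    using assms(2) zero_le_dist[of q x] zero_le_dist[of x r] dist_self[of q] by (metis add_nonneg_eq_0_iff)+
  with True show ?thesis by simp
next
  case False
  define d l where "d = dist q r" and "l = dist q x / dist q r"
  have d: "d > 0" using False by (simp add: d_def)
  have l: "dist q x = l * d" "dist x r = (1 - l) * d" "0 \<le> l" "l \<le> 1"
  proof -
    show "dist q x = l * d" using d by (simp add: l_def d_def)
    then show "dist x r = (1 - l) * d" using assms(2) by (simp add: d_def algebra_simps)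
    show "0 \<le> l" by (simp add: l_def)
    have "dist q x \<le> dist q r" using assms(2) zero_le_dist[of x r] by linarith
    then show "l \<le> 1" using d by (simp add: l_def d_def)
  qed
  obtain T where T: "geodesic_segment q r T" "x \<in> T"
    using geodesic_segment_through[OF assms] by blast
  obtain S U where S: "geodesic_segment p q S" and U: "geodesic_segment r p U"
    using assms(1) unfolding CAT0_def by metis
  obtain p' q' r' where tri: "comparison_triangle p q r p' q' r'"
    by (rule comparison_triangle_exists)
  define x' where "x' = (1 - l) *\<^sub>R q' + l *\<^sub>R r'"
  have qr: "dist q' r' = d" "dist p' q' = dist p q" "dist p' r' = dist p r"
    using tri by (auto simp: comparison_triangle_def d_def dist_commute)
  have "x' - q' = l *\<^sub>R (r' - q')" by (simp add: x'_def algebra_simps)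
  then have "dist q' x' = l * d"
    using l qr(1) by (simp add: dist_norm norm_minus_commute[of q' x'] norm_minus_commute[of r' q'])
  then have "comparison_point q T q' r' x x'"
    using T(2) l by (auto simp: comparison_point_def x'_def closed_segment_def)
  moreover have "p \<in> S" using S by (force simp: geodesic_segment_def)
  then have "comparison_point p S p' q' p p'" by (auto simp: comparison_point_def)
  ultimately have "dist p x \<le> dist p' x'"
    using assms(1) S T(1) U tri unfolding CAT0_def Let_def by blast
  then have "(dist p x)\<^sup>2 \<le> (dist p' x')\<^sup>2" by (intro power_mono) auto
  also have "\<dots> = (1 - l) * (dist p' q')\<^sup>2 + l * (dist p' r')\<^sup>2 - l * (1 - l) * (dist q' r')\<^sup>2"
  proof -
    define u v where "u = q' - p'" and "v = r' - p'"
    have "x' - p' = (1 - l) *\<^sub>R u + l *\<^sub>R v" "q' - r' = u - v"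
      by (simp_all add: x'_def u_def v_def algebra_simps)
    then have "dist p' x' = norm ((1 - l) *\<^sub>R u + l *\<^sub>R v)" "dist q' r' = norm (u - v)"
      "dist p' q' = norm u" "dist p' r' = norm v"
      by (simp_all add: dist_norm u_def v_def norm_minus_commute[of p'])
    then show ?thesis
      by (simp add: power2_norm_eq_inner inner_add inner_diff inner_commute[of v u] algebra_simps)
  qed
  finally have "d * (dist p x)\<^sup>2 \<le> d * ((1 - l) * (dist p q)\<^sup>2 + l * (dist p r)\<^sup>2 - l * (1 - l) * d\<^sup>2)"
    using d qr by simp
  then show ?thesis unfolding l d_def[symmetric] by (simp add: power2_eq_square algebra_simps)
qed

section \<open>Cosines of comparison angles\<close>

text \<open>
  Cosines are used in place of comparison angles because they turn all comparisons into polynomial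
  inequalities between distances. A larger cosine means a smaller angle.
\<close>

definition comparison_cos :: "'a::metric_space \<Rightarrow> 'a \<Rightarrow> 'a \<Rightarrow> real" where
  "comparison_cos p q r =
     ((dist p q)\<^sup>2 + (dist p r)\<^sup>2 - (dist q r)\<^sup>2) / (2 * dist p q * dist p r)"

lemma comparison_cos_commute: "comparison_cos p q r = comparison_cos p r q"
  by (simp add: comparison_cos_def dist_commute mult.commute mult.left_commute add.commute)

lemma comparison_cos_bounds:
  fixes p q r :: "'a::metric_space"
  assumes "p \<noteq> q" "p \<noteq> r"
  shows "-1 \<le> comparison_cos p q r" "comparison_cos p q r \<le> 1"
proof -
  define a b d where "a = dist p q" and "b = dist p r" and "d = dist q r"
  have pos: "a > 0" "b > 0" using assms by (auto simp: a_def b_def)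
  have tri: "d \<le> a + b" "a \<le> b + d" "b \<le> a + d" "d \<ge> 0"
    unfolding a_def b_def d_def
    by (metis dist_commute dist_triangle add.commute zero_le_dist)+
  have "d\<^sup>2 \<le> (a + b)\<^sup>2" using tri by (intro power_mono) auto
  then have "-1 \<le> (a\<^sup>2 + b\<^sup>2 - d\<^sup>2) / (2 * a * b)"
    using pos by (simp add: field_simps power2_eq_square)
  then show "-1 \<le> comparison_cos p q r" by (simp add: comparison_cos_def a_def b_def d_def)
  have "(a - b)\<^sup>2 \<le> d\<^sup>2" using tri by (intro abs_le_square_iff[THEN iffD1]) auto
  then have "(a\<^sup>2 + b\<^sup>2 - d\<^sup>2) / (2 * a * b) \<le> 1"
    using pos by (simp add: field_simps power2_eq_square)
  then show "comparison_cos p q r \<le> 1" by (simp add: comparison_cos_def a_def b_def d_def)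
qed

lemma comparison_angle_eq_arccos:
  "p \<noteq> q \<Longrightarrow> p \<noteq> r \<Longrightarrow> comparison_angle p q r = arccos (comparison_cos p q r)"
  by (simp add: comparison_angle_eq comparison_cos_def)

text \<open>
  Stewart's inequality, rewritten: moving one vertex towards \<open>p\<close> can only decrease the
  comparison angle at \<open>p\<close>.
\<close>

lemma comparison_cos_shrink:
  fixes p q r x :: "'a::metric_space"
  assumes "CAT0 TYPE('a)" "dist p x + dist x q = dist p q" "p \<noteq> x" "p \<noteq> r"
  shows "comparison_cos p q r \<le> comparison_cos p x r"
proof -
  define a b d l m where "a = dist p x" and "b = dist p r" and "d = dist p q"
    and "l = dist q r" and "m = dist x r"
  have pos: "a > 0" "b > 0" using assms by (auto simp: a_def b_def)
  have ad: "dist x q = d - a" "a \<le> d" using assms(2) zero_le_dist[of x q] unfolding a_def d_def by linarith+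
  have "d * m\<^sup>2 \<le> (d - a) * b\<^sup>2 + a * l\<^sup>2 - a * (d - a) * d"
    using CAT0_stewart[OF assms(1,2), of r] ad(1)
    by (simp add: a_def b_def d_def l_def m_def dist_commute)
  then have "a * (d\<^sup>2 + b\<^sup>2 - l\<^sup>2) \<le> d * (a\<^sup>2 + b\<^sup>2 - m\<^sup>2)"
    by (simp add: power2_eq_square algebra_simps)
  then have "(d\<^sup>2 + b\<^sup>2 - l\<^sup>2) / (2 * d * b) \<le> (a\<^sup>2 + b\<^sup>2 - m\<^sup>2) / (2 * a * b)"
    using pos ad(2) by (simp add: divide_simps) (simp add: mult_ac)
  then show ?thesis by (simp add: comparison_cos_def a_def b_def d_def l_def m_def)
qed

lemma comparison_cos_antimono:
  fixes p q r x y :: "'a::metric_space"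
  assumes "CAT0 TYPE('a)" "dist p x + dist x q = dist p q" "dist p y + dist y r = dist p r"
    "p \<noteq> x" "p \<noteq> y"
  shows "comparison_cos p q r \<le> comparison_cos p x y"
proof -
  have "p \<noteq> r" using assms(3,5) zero_le_dist[of y r] zero_less_dist_iff[of p y] by fastforce
  then have "comparison_cos p q r \<le> comparison_cos p x r"
    by (intro comparison_cos_shrink) (use assms in auto)
  also have "\<dots> \<le> comparison_cos p x y"
    using comparison_cos_shrink[OF assms(1,3,5,4)] by (simp add: comparison_cos_commute)
  finally show ?thesis .
qed

text \<open>
  Seen from the midpoint \<open>p\<close> of \<open>x\<close> and \<open>y\<close>, the comparison angles to \<open>x\<close> and to \<open>y\<close> add up to at least
  \<open>\<pi>\<close>; this is Stewart's inequality at a midpoint. It replaces the triangle inequality for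
  Alexandrov angles.
\<close>

lemma comparison_cos_opposite:
  fixes p x y z :: "'a::metric_space"
  assumes "CAT0 TYPE('a)" "dist p x = s" "dist p y = s" "dist x y = 2 * s" "s > 0" "p \<noteq> z"
  shows "comparison_cos p y z \<le> - comparison_cos p x z"
proof -
  define b where "b = dist p z"
  have b: "b > 0" using assms by (simp add: b_def)
  have "2 * s * b\<^sup>2 \<le> s * (dist z x)\<^sup>2 + s * (dist z y)\<^sup>2 - s * s * (2 * s)"
    using CAT0_stewart[OF assms(1), of x p y z] assms(2-4)
    by (simp add: b_def dist_commute)
  also have "\<dots> = s * ((dist z x)\<^sup>2 + (dist z y)\<^sup>2 - 2 * s\<^sup>2)"
    by (simp add: power2_eq_square algebra_simps)
  finally have "2 * b\<^sup>2 \<le> (dist x z)\<^sup>2 + (dist y z)\<^sup>2 - 2 * s\<^sup>2"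
    using assms(5) by (simp add: dist_commute)
  then have "s\<^sup>2 + b\<^sup>2 - (dist y z)\<^sup>2 \<le> - (s\<^sup>2 + b\<^sup>2 - (dist x z)\<^sup>2)" by simp
  then have "(s\<^sup>2 + b\<^sup>2 - (dist y z)\<^sup>2) / (2 * s * b) \<le> - (s\<^sup>2 + b\<^sup>2 - (dist x z)\<^sup>2) / (2 * s * b)"
    using b assms(5) by (intro divide_right_mono) auto
  then show ?thesis unfolding comparison_cos_def b_def assms(2,3) by (simp only: minus_divide_left)
qed

text \<open>
  Contracting a geodesic triangle towards one vertex shrinks the opposite side at least as much as
  in the plane, since the comparison angle at \<open>p\<close> does not grow.
\<close>

lemma CAT0_dist_scaled_le:
  fixes p q r x y :: "'a::metric_space"
  assumes "CAT0 TYPE('a)" "dist p x = l * dist p q" "dist x q = (1 - l) * dist p q"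
    "dist p y = l * dist p r" "dist y r = (1 - l) * dist p r" "l \<ge> 0"
  shows "dist x y \<le> l * dist q r"
proof (cases "p = x \<or> p = y")
  case False
  then have "l \<noteq> 0" and pos: "dist p q > 0" "dist p r > 0"
    using assms(2,4) by auto
  then have l: "l > 0" using assms(6) by simp
  have "comparison_cos p q r \<le> comparison_cos p x y"
    using False assms by (intro comparison_cos_antimono) (auto simp: algebra_simps)
  then have "(l\<^sup>2 * ((dist p q)\<^sup>2 + (dist p r)\<^sup>2 - (dist q r)\<^sup>2)) / (2 * (l * dist p q) * (l * dist p r))
      \<le> ((l * dist p q)\<^sup>2 + (l * dist p r)\<^sup>2 - (dist x y)\<^sup>2) / (2 * (l * dist p q) * (l * dist p r))"
    using l pos by (simp add: comparison_cos_def assms(2,4) power2_eq_square)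
  then have "l\<^sup>2 * ((dist p q)\<^sup>2 + (dist p r)\<^sup>2 - (dist q r)\<^sup>2) \<le> (l * dist p q)\<^sup>2 + (l * dist p r)\<^sup>2 - (dist x y)\<^sup>2"
    using l pos by (subst (asm) divide_le_cancel) (auto simp: zero_less_mult_iff)
  then have "(dist x y)\<^sup>2 \<le> (l * dist q r)\<^sup>2" by (simp add: power_mult_distrib algebra_simps)
  then show ?thesis by (rule power2_le_imp_le) (simp add: assms(6))
next
  case True
  then show ?thesis
  proof (cases "l = 0")
    case False
    have "(p = x \<and> p = q) \<or> (p = y \<and> p = r)" using True False assms(2,4) by fastforce
    then show ?thesis using assms(2-5) dist_commute[of p] by auto
  qed (use assms in auto)
qed

section \<open>Asymptotic rays\<close>

lemma geodesic_ray_dist: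
  "\<lbrakk>geodesic_ray c; 0 \<le> s; 0 \<le> t\<rbrakk> \<Longrightarrow> dist (c s) (c t) = \<bar>s - t\<bar>"
  by (simp add: geodesic_ray_def)

lemma geodesic_ray_eqI:
  "\<lbrakk>geodesic_ray c; geodesic_ray c'; \<And>t. t > 0 \<Longrightarrow> c t = c' t; c 0 = c' 0\<rbrakk> \<Longrightarrow> c = c'"
  by (rule extensionalityI[of _ "{0..}"]) (auto simp: geodesic_ray_def order_le_less)

lemma asymptoticD:
  assumes "(c, c') \<in> asymptotic"
  shows "\<exists>M\<ge>0. \<forall>t\<ge>0. dist (c t) (c' t) \<le> M"
proof -
  obtain M where "\<forall>y\<in>(\<lambda>x. dist (c x) (c' x)) ` {0..}. norm y \<le> M"
    using assms unfolding asymptotic_def bounded_iff by blast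
  then have "\<And>t. t \<ge> 0 \<Longrightarrow> dist (c t) (c' t) \<le> M" by auto
  moreover have "M \<ge> 0" using calculation[of 0] zero_le_dist[of "c 0" "c' 0"] order_trans by blast
  ultimately show ?thesis by blast
qed

lemma asymptoticI:
  assumes "geodesic_ray c" "geodesic_ray c'" "\<And>t. t \<ge> 0 \<Longrightarrow> dist (c t) (c' t) \<le> M"
  shows "(c, c') \<in> asymptotic"
  using assms unfolding asymptotic_def by (auto intro!: boundedI[of _ M])

lemma asymptotic_rays: "(c, c') \<in> asymptotic \<Longrightarrow> geodesic_ray c \<and> geodesic_ray c'"
  by (simp add: asymptotic_def)

lemma asymptotic_sym: "(c, c') \<in> asymptotic \<Longrightarrow> (c', c) \<in> asymptotic"
  by (simp add: asymptotic_def dist_commute)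

lemma asymptotic_trans:
  assumes "(c, c') \<in> asymptotic" "(c', c'') \<in> asymptotic"
  shows "(c, c'') \<in> asymptotic"
proof -
  obtain M where "M \<ge> 0" and M: "\<And>t. t \<ge> 0 \<Longrightarrow> dist (c t) (c' t) \<le> M"
    using asymptoticD[OF assms(1)] by blast
  obtain N where "N \<ge> 0" and N: "\<And>t. t \<ge> 0 \<Longrightarrow> dist (c' t) (c'' t) \<le> N"
    using asymptoticD[OF assms(2)] by blast
  have "dist (c t) (c'' t) \<le> M + N" if "t \<ge> 0" for t
    using M[OF that] N[OF that] dist_triangle[of "c t" "c'' t" "c' t"] by linarith
  then show ?thesis using asymptotic_rays[OF assms(1)] asymptotic_rays[OF assms(2)]
    by (intro asymptoticI) auto
qed

lemma comparison_cos_rays_antimono: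
  fixes c c' :: "real \<Rightarrow> 'a::metric_space"
  assumes "CAT0 TYPE('a)" "geodesic_ray c" "geodesic_ray c'" "c 0 = p" "c' 0 = p"
    "0 < s" "s \<le> s'" "0 < t" "t \<le> t'"
  shows "comparison_cos p (c s') (c' t') \<le> comparison_cos p (c s) (c' t)"
proof (rule comparison_cos_antimono[OF assms(1)])
  have d: "dist p (c u) = u" "dist p (c' u) = u" if "u \<ge> 0" for u
    using geodesic_ray_dist[OF assms(2), of 0 u] geodesic_ray_dist[OF assms(3), of 0 u] assms(4,5) that
    by auto
  show "dist p (c s) + dist (c s) (c s') = dist p (c s')"
    "dist p (c' t) + dist (c' t) (c' t') = dist p (c' t')"
    using assms(6-9) geodesic_ray_dist[OF assms(2), of s s'] geodesic_ray_dist[OF assms(3), of t t'] d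
    by auto
  show "p \<noteq> c s" "p \<noteq> c' t" using d[of s] d[of t] assms(6,8) by auto
qed

lemma rays_dist_ratio_mono:
  fixes c c' :: "real \<Rightarrow> 'a::metric_space"
  assumes "CAT0 TYPE('a)" "geodesic_ray c" "geodesic_ray c'" "c 0 = c' 0" "0 \<le> s" "s \<le> t"
  shows "t * dist (c s) (c' s) \<le> s * dist (c t) (c' t)"
proof (cases "s = 0")
  case False
  define l where "l = s / t"
  have t: "t > 0" and s: "s = l * t" "l \<ge> 0" using False assms(5,6) by (auto simp: l_def)
  have "dist (c s) (c' s) \<le> l * dist (c t) (c' t)"
    using geodesic_ray_dist[OF assms(2), of 0 s] geodesic_ray_dist[OF assms(2), of 0 t]
      geodesic_ray_dist[OF assms(2), of s t] geodesic_ray_dist[OF assms(3), of 0 s]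
      geodesic_ray_dist[OF assms(3), of 0 t] geodesic_ray_dist[OF assms(3), of s t] assms(4-6) t s
    by (intro CAT0_dist_scaled_le[OF assms(1), of "c 0"]) (auto simp: algebra_simps)
  then have "t * dist (c s) (c' s) \<le> t * (l * dist (c t) (c' t))" using t by simp
  then show ?thesis using s(1) by (simp add: mult_ac)
qed (use assms in auto)

text \<open>
  The ratio \<open>dist (c t) (c' t) / t\<close> is nondecreasing, and it tends to zero when the distance is
  bounded.
\<close>

lemma asymptotic_unique:
  fixes c c' :: "real \<Rightarrow> 'a::metric_space"
  assumes "CAT0 TYPE('a)" "(c, c') \<in> asymptotic" "c 0 = c' 0"
  shows "c = c'"
proof (rule geodesic_ray_eqI)
  show ray: "geodesic_ray c" "geodesic_ray c'" using asymptotic_rays[OF assms(2)] by auto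
  obtain M where M: "M \<ge> 0" "\<And>t. t \<ge> 0 \<Longrightarrow> dist (c t) (c' t) \<le> M"
    using asymptoticD[OF assms(2)] by blast
  fix t :: real assume t: "t > 0"
  have "dist (c t) (c' t) \<le> 0"
  proof (rule ccontr)
    assume "\<not> ?thesis"
    then have pos: "dist (c t) (c' t) > 0" by simp
    \<comment> \<open>At this parameter monotonicity of the ratio would force a distance above \<open>M\<close>.\<close>
    define u where "u = t + t * M / dist (c t) (c' t)"
    have "t \<le> u" using t M(1) by (simp add: u_def)
    then have "u * dist (c t) (c' t) \<le> t * M"
      using rays_dist_ratio_mono[OF assms(1) ray assms(3), of t u] M(2)[of u] t
      by (smt (verit) mult_left_mono)
    moreover have "u * dist (c t) (c' t) = t * dist (c t) (c' t) + t * M"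
      using pos by (simp add: u_def distrib_right)
    ultimately show False using mult_pos_pos[OF t pos] by linarith
  qed
  then show "c t = c' t" by simp
qed (fact assms(3))

text \<open>
  Two far points of a ray are seen from \<open>p\<close> under a small angle, uniformly in the farther one: by the
  triangle inequality, passing from \<open>c 0\<close> to \<open>p\<close> perturbs all distances by at most \<open>M\<close>.
\<close>

lemma comparison_cos_far_points:
  assumes ray: "geodesic_ray c" and M: "dist p (c 0) \<le> M" and mn: "2 * M < m" "m \<le> n" "0 < m"
  shows "1 - comparison_cos p (c m) (c n) \<le> 4 * M / (m - M)"
proof -
  define a b where "a = dist p (c m)" and "b = dist p (c n)"
  have M0: "M \<ge> 0" using M zero_le_dist[of p "c 0"] by linarith
  have d: "dist (c 0) (c m) = m" "dist (c 0) (c n) = n" "dist (c m) (c n) = n - m"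
    using geodesic_ray_dist[OF ray, of 0 m] geodesic_ray_dist[OF ray, of 0 n]
      geodesic_ray_dist[OF ray, of m n] mn by auto
  have a: "a \<ge> m - M" "a \<le> m + M" and b: "b \<ge> n - M" "b \<le> n + M"
    using dist_triangle[of p "c m" "c 0"] dist_triangle[of "c 0" "c m" p] dist_triangle[of p "c n" "c 0"]
      dist_triangle[of "c 0" "c n" p] M d unfolding a_def b_def by (auto simp: dist_commute)
  have ba: "b - a \<le> n - m" "a - b \<le> n - m"
    using dist_triangle[of p "c n" "c m"] dist_triangle[of p "c m" "c n"] d(3)
    unfolding a_def b_def by (auto simp: dist_commute)
  have pos: "a > 0" "b > 0" "m - M > 0" using a b mn M0 by auto
  have "(n - m)\<^sup>2 - (b - a)\<^sup>2 = (n - m - (b - a)) * (n - m + (b - a))"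
    by (simp add: power2_eq_square algebra_simps)
  also have "\<dots> \<le> (2 * M) * (2 * (n - m))" using a b ba mn by (intro mult_mono) auto
  also have "\<dots> \<le> (2 * M) * (2 * (2 * b))"
    using M0 b mn by (intro mult_left_mono) auto
  finally have "(n - m)\<^sup>2 - (b - a)\<^sup>2 \<le> 8 * M * b" by simp
  then have "((n - m)\<^sup>2 - (b - a)\<^sup>2) / (2 * a * b) \<le> 8 * M * b / (2 * a * b)"
    using pos by (intro divide_right_mono) auto
  also have "\<dots> = 4 * M / a" using pos by simp
  also have "\<dots> \<le> 4 * M / (m - M)" using a pos M0 by (intro divide_left_mono) auto
  also have "((n - m)\<^sup>2 - (b - a)\<^sup>2) / (2 * a * b) = 1 - comparison_cos p (c m) (c n)"
    using pos unfolding comparison_cos_def a_def[symmetric] b_def[symmetric] d(3)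
    by (simp add: field_simps power2_eq_square)
  finally show ?thesis .
qed

text \<open>
  The segments \<open>\<sigma> n\<close> from \<open>p\<close> to \<open>c n\<close> converge, since their endpoints are seen from \<open>p\<close> under
  angles that tend to zero, and each stays within \<open>2 * M\<close> of \<open>c\<close>. The segments are part of the
  conclusion because the angle estimate \<open>comparison_cos_along_ray\<close> needs to approximate the ray
  from \<open>p\<close> by segments with endpoints on \<open>c\<close>.
\<close>

lemma asymptotic_ray_from:
  fixes c :: "real \<Rightarrow> 'a::complete_space" and p :: 'a
  assumes CAT0: "CAT0 TYPE('a)" and ray: "geodesic_ray c"
  obtains c' \<sigma> where "(c, c') \<in> asymptotic" "c' 0 = p"
    "\<And>t. t \<ge> 0 \<Longrightarrow> (\<lambda>n. \<sigma> n t) \<longlonglongrightarrow> c' t"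
    "\<And>n t. \<lbrakk>0 \<le> t; t \<le> dist p (c (real n))\<rbrakk> \<Longrightarrow>
       dist p (\<sigma> n t) = t \<and> dist (\<sigma> n t) (c (real n)) = dist p (c (real n)) - t"
proof -
  define M where "M = dist p (c 0)"
  define D where "D n = dist p (c (real n))" for n :: nat
  have M0: "M \<ge> 0" by (simp add: M_def)
  have d0: "dist (c 0) (c t) = t" if "t \<ge> 0" for t using geodesic_ray_dist[OF ray, of 0 t] that by simp
  have D: "D n \<ge> n - M" "D n \<le> n + M" for n
    using dist_triangle[of "c 0" "c n" p] dist_triangle[of p "c n" "c 0"] d0[of n]
    by (auto simp: D_def M_def dist_commute)
  have "\<exists>e. e 0 = p \<and> e (D n) = c n \<and>
      (\<forall>s t. 0 \<le> s \<and> s \<le> D n \<and> 0 \<le> t \<and> t \<le> D n \<longrightarrow> dist (e s) (e t) = \<bar>s - t\<bar>)" for n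
    unfolding D_def using CAT0_geodesic[OF CAT0, of p "c n"] by metis
  then obtain \<sigma> where \<sigma>: "\<And>n. \<sigma> n 0 = p" "\<And>n. \<sigma> n (D n) = c n"
    and iso: "\<And>n s t. \<lbrakk>0 \<le> s; s \<le> D n; 0 \<le> t; t \<le> D n\<rbrakk> \<Longrightarrow> dist (\<sigma> n s) (\<sigma> n t) = \<bar>s - t\<bar>"
    by metis
  have \<sigma>d: "dist p (\<sigma> n t) = t" "dist (\<sigma> n t) (c n) = D n - t" if "0 \<le> t" "t \<le> D n" for n t
    using iso[of 0 n t] iso[of t n "D n"] \<sigma> that by auto
  have close: "(dist (\<sigma> m t) (\<sigma> n t))\<^sup>2 \<le> 8 * t\<^sup>2 * M / (m - M)"
    if t: "t > 0" and mn: "m \<le> n" "2 * M < m" "t + M \<le> m" for m n t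
  proof -
    have Dt: "t \<le> D m" "t \<le> D n" using D[of m] D[of n] mn by auto
    have "0 < m" using t M0 mn(3) by (intro Nat.gr0I) auto
    have "comparison_cos p (c m) (c n) \<le> comparison_cos p (\<sigma> m t) (\<sigma> n t)"
      using \<sigma>d[of t m] \<sigma>d[of t n] Dt t by (intro comparison_cos_antimono[OF CAT0]) (auto simp: D_def)
    moreover have "1 - comparison_cos p (c m) (c n) \<le> 4 * M / (m - M)"
      using mn M0 \<open>0 < m\<close> by (intro comparison_cos_far_points[OF ray]) (simp_all add: M_def)
    ultimately have "1 - comparison_cos p (\<sigma> m t) (\<sigma> n t) \<le> 4 * M / (m - M)" by linarith
    moreover have "1 - comparison_cos p (\<sigma> m t) (\<sigma> n t) = (dist (\<sigma> m t) (\<sigma> n t))\<^sup>2 / (2 * t\<^sup>2)"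
      using \<sigma>d[of t m] \<sigma>d[of t n] Dt t
      by (simp add: comparison_cos_def field_simps power2_eq_square)
    ultimately have "(dist (\<sigma> m t) (\<sigma> n t))\<^sup>2 \<le> 4 * M / (m - M) * (2 * t\<^sup>2)"
      using t by (simp add: divide_le_eq)
    then show ?thesis by (simp add: mult_ac)
  qed
  have Cauchy: "Cauchy (\<lambda>n. \<sigma> n t)" if "t \<ge> 0" for t
  proof (cases "t = 0")
    case True then show ?thesis by (simp add: \<sigma> Cauchy_def)
  next
    case False
    with that have t: "t > 0" by simp
    show ?thesis
    proof (rule CauchyI')
      fix e :: real assume e: "e > 0"
      obtain N :: nat where N: "2 * M + t + 8 * t\<^sup>2 * M / e\<^sup>2 < N" using reals_Archimedean2 by blast
      have q: "8 * t\<^sup>2 * M / e\<^sup>2 \<ge> 0" using M0 by simp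
      have "dist (\<sigma> m t) (\<sigma> n t) < e" if mn: "m \<ge> N" "n > m" for m n
      proof -
        have m: "8 * t\<^sup>2 * M / e\<^sup>2 < m - M" "2 * M < m" "t + M \<le> m" "M < m"
          using N mn(1) q M0 t by linarith+
        have "(dist (\<sigma> m t) (\<sigma> n t))\<^sup>2 \<le> 8 * t\<^sup>2 * M / (m - M)"
          using mn(2) m by (intro close[OF t]) auto
        also have "\<dots> < e\<^sup>2"
        proof -
          have "8 * t\<^sup>2 * M < (m - M) * e\<^sup>2" using m(1) e by (simp add: pos_divide_less_eq)
          then show ?thesis using m(4) by (simp add: pos_divide_less_eq mult.commute)
        qed
        finally show ?thesis by (rule power2_less_imp_less) (use e in simp)
      qed
      then show "\<exists>N. \<forall>m\<ge>N. \<forall>n>m. dist (\<sigma> m t) (\<sigma> n t) < e" by blast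
    qed
  qed
  define c' where "c' t = (if t \<ge> 0 then lim (\<lambda>n. \<sigma> n t) else undefined)" for t
  have lim: "(\<lambda>n. \<sigma> n t) \<longlonglongrightarrow> c' t" if "t \<ge> 0" for t
    using Cauchy_convergent[OF Cauchy[OF that]] that by (simp add: c'_def convergent_LIMSEQ_iff)
  have large: "\<forall>\<^sub>F n in sequentially. t \<le> D n \<and> D n > 0" for t
  proof -
    have "\<forall>\<^sub>F n in sequentially. \<bar>t\<bar> + M + 1 \<le> real n" 
      using eventually_ge_at_top[of "nat \<lceil>\<bar>t\<bar> + M + 1\<rceil>"] by eventually_elim linarith
    then show ?thesis by (rule eventually_mono) (use D(1) in \<open>smt (verit)\<close>)
  qed
  have ray': "geodesic_ray c'"
    unfolding geodesic_ray_def
  proof (intro conjI allI impI)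
    fix s t :: real assume st: "s \<ge> 0" "t \<ge> 0"
    have "(\<lambda>n. dist (\<sigma> n s) (\<sigma> n t)) \<longlonglongrightarrow> dist (c' s) (c' t)"
      by (intro tendsto_dist lim st)
    moreover have "\<forall>\<^sub>F n in sequentially. dist (\<sigma> n s) (\<sigma> n t) = \<bar>s - t\<bar>"
      using large[of s] large[of t] by eventually_elim (use st iso in auto)
    then have "(\<lambda>n. dist (\<sigma> n s) (\<sigma> n t)) \<longlonglongrightarrow> \<bar>s - t\<bar>" by (rule tendsto_eventually)
    ultimately show "dist (c' s) (c' t) = \<bar>s - t\<bar>" by (rule LIMSEQ_unique)
  qed (auto simp: c'_def extensional_def)
  have "dist (c t) (c' t) \<le> 2 * M" if t: "t \<ge> 0" for t
  proof (rule tendsto_upperbound)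
    show "(\<lambda>n. dist (c t) (\<sigma> n t)) \<longlonglongrightarrow> dist (c t) (c' t)"
      by (intro tendsto_dist lim t tendsto_const)
    show "\<forall>\<^sub>F n in sequentially. dist (c t) (\<sigma> n t) \<le> 2 * M"
      using large[of t]
    proof eventually_elim
      case (elim n)
      define l where "l = (D n - t) / D n"
      have l: "l * D n = D n - t" "(1 - l) * D n = t" "0 \<le> l" "l \<le> 1"
        using elim t by (auto simp: l_def field_simps)
      have ln: "l * n \<le> n" using l by (simp add: mult_left_le_one_le)
      \<comment> \<open>Contract towards \<open>c n\<close> by the factor \<open>l\<close>: this moves \<open>p\<close> to \<open>\<sigma> n t\<close> and \<open>c 0\<close> to \<open>y\<close>.\<close>
      define y where "y = c ((1 - l) * n)"
      have y: "dist (c n) y = l * n" "dist y (c 0) = (1 - l) * n"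
        using geodesic_ray_dist[OF ray, of n "(1 - l) * n"] geodesic_ray_dist[OF ray, of "(1 - l) * n" 0]
          l ln by (auto simp: y_def left_diff_distrib)
      have "dist (\<sigma> n t) y \<le> l * dist p (c 0)"
        using \<sigma>d[of t n] l y t elim d0[of n]
        by (intro CAT0_dist_scaled_le[OF CAT0, of "c n"]) (auto simp: dist_commute D_def)
      also have "\<dots> \<le> M" using l M0 by (simp add: M_def mult_left_le_one_le)
      finally have "dist (\<sigma> n t) y \<le> M" .
      moreover have "dist y (c t) \<le> M"
      proof -
        have "dist y (c t) = \<bar>(1 - l) * n - (1 - l) * D n\<bar>"
          using geodesic_ray_dist[OF ray, of "(1 - l) * n" t] l t by (simp add: y_def)
        also have "\<dots> = (1 - l) * \<bar>n - D n\<bar>" using l(4) by (simp only: right_diff_distrib[symmetric] abs_mult)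
        also have "\<dots> \<le> 1 * M" by (rule mult_mono) (use l(3,4) D[of n] in auto)
        finally show ?thesis by simp
      qed
      ultimately show ?case
        using dist_triangle[of "c t" "\<sigma> n t" y] by (simp add: dist_commute)
    qed
  qed simp
  then have "(c, c') \<in> asymptotic" by (rule asymptoticI[OF ray ray'])
  moreover have "c' 0 = p" using lim[of 0] \<sigma>(1) LIMSEQ_unique[OF _ tendsto_const] by simp
  ultimately show ?thesis using lim \<sigma>d by (intro that[of c' \<sigma>]) (auto simp: D_def)
qed

section \<open>The limiting comparison angle of two rays\<close>

text \<open>
  The distance between the two directions in the Euclidean cone over the boundary. Sampling at
  integers loses nothing, as the ratio is monotone for rays with the same starting point.
\<close>

definition limit_slope :: "(real \<Rightarrow> 'a::metric_space) \<Rightarrow> (real \<Rightarrow> 'a) \<Rightarrow> real" where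
  "limit_slope c c' = lim (\<lambda>n. dist (c (real n)) (c' (real n)) / real n)"

text \<open>
  The ratio \<open>dist (c t) (c' t) / t\<close> is nondecreasing and bounded by \<open>2\<close>, so its limit exists and is its
  supremum.
\<close>

lemma limit_slope:
  fixes c c' :: "real \<Rightarrow> 'a::metric_space"
  assumes CAT0: "CAT0 TYPE('a)" and rays: "geodesic_ray c" "geodesic_ray c'" and start: "c 0 = c' 0"
  shows limit_slope_tendsto: "(\<lambda>n. dist (c (real n)) (c' (real n)) / real n) \<longlonglongrightarrow> limit_slope c c'"
    and dist_le_limit_slope: "t \<ge> 0 \<Longrightarrow> dist (c t) (c' t) \<le> limit_slope c c' * t"
    and limit_slope_ge_0: "0 \<le> limit_slope c c'"
    and limit_slope_le_2: "limit_slope c c' \<le> 2"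
proof -
  define X where "X n = dist (c (real n)) (c' (real n)) / real n" for n
  have mono: "dist (c t) (c' t) \<le> t * X n" if "0 \<le> t" "t \<le> n" for t n
  proof (cases "n = 0")
    case False
    with rays_dist_ratio_mono[OF CAT0 rays start that] show ?thesis
      by (simp add: X_def field_simps)
  qed (use that start in simp)
  have "incseq X"
  proof (rule incseq_SucI)
    fix n
    show "X n \<le> X (Suc n)"
      using mono[of "real n" "Suc n"]
      by (cases "n = 0") (simp_all add: X_def pos_divide_le_eq mult.commute)
  qed
  moreover have "X n \<le> 2" for n
  proof -
    have "dist (c n) (c' n) \<le> real n + real n"
      using dist_triangle[of "c n" "c' n" "c 0"] geodesic_ray_dist[OF rays(1), of n 0]
        geodesic_ray_dist[OF rays(2), of 0 n] start by simp
    then show ?thesis by (cases "n = 0") (simp_all add: X_def pos_divide_le_eq)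
  qed
  ultimately obtain L where L: "X \<longlonglongrightarrow> L" "\<forall>n. X n \<le> L" using incseq_convergent[of X 2] by blast
  have "limit_slope c c' = L" using limI[OF L(1)] by (simp add: limit_slope_def X_def[abs_def])
  with L(1) show lim: "(\<lambda>n. dist (c (real n)) (c' (real n)) / real n) \<longlonglongrightarrow> limit_slope c c'"
    by (simp add: X_def[abs_def])
  show "0 \<le> limit_slope c c'"
    using \<open>limit_slope c c' = L\<close> L(2)[rule_format, of 0] by (simp add: X_def)
  show "limit_slope c c' \<le> 2"
    using \<open>\<And>n. X n \<le> 2\<close> L(1) \<open>limit_slope c c' = L\<close> LIMSEQ_le_const2 by blast
  assume t: "t \<ge> 0"
  obtain n :: nat where n: "t \<le> n" using real_arch_simple by blast
  have "dist (c t) (c' t) \<le> t * X n" by (rule mono[OF t n])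
  also have "\<dots> \<le> t * limit_slope c c'"
    using L(2) \<open>limit_slope c c' = L\<close> t by (intro mult_left_mono) auto
  finally show "dist (c t) (c' t) \<le> limit_slope c c' * t" by (simp add: mult.commute)
qed

lemma limit_slope_asymptotic:
  fixes c c' d d' :: "real \<Rightarrow> 'a::metric_space"
  assumes "CAT0 TYPE('a)" "(c, d) \<in> asymptotic" "(c', d') \<in> asymptotic" "c 0 = c' 0" "d 0 = d' 0"
  shows "limit_slope c c' = limit_slope d d'"
proof -
  have rays: "geodesic_ray c" "geodesic_ray d" "geodesic_ray c'" "geodesic_ray d'"
    using asymptotic_rays[OF assms(2)] asymptotic_rays[OF assms(3)] by auto
  obtain M where M: "\<And>t. t \<ge> 0 \<Longrightarrow> dist (c t) (d t) \<le> M" using asymptoticD[OF assms(2)] by blast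
  obtain N where N: "\<And>t. t \<ge> 0 \<Longrightarrow> dist (c' t) (d' t) \<le> N" using asymptoticD[OF assms(3)] by blast
  have "(\<lambda>n. dist (c (real n)) (c' (real n)) / real n - dist (d (real n)) (d' (real n)) / real n) \<longlonglongrightarrow> 0"
  proof (rule Lim_null_comparison)
    show "(\<lambda>n. (M + N) / real n) \<longlonglongrightarrow> 0" by (rule lim_const_over_n)
    have "\<bar>dist (c (real n)) (c' (real n)) - dist (d (real n)) (d' (real n))\<bar> \<le> M + N" for n
      using M[of n] N[of n] dist_triangle[of "c n" "c' n" "d n"] dist_triangle[of "d n" "c' n" "d' n"]
        dist_triangle[of "d n" "d' n" "c n"] dist_triangle[of "c n" "d' n" "c' n"]
      by (simp add: dist_commute)
    then show "\<forall>\<^sub>F n in sequentially. norm (dist (c (real n)) (c' (real n)) / real n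
        - dist (d (real n)) (d' (real n)) / real n) \<le> (M + N) / real n"
      by (intro always_eventually allI) (simp add: divide_right_mono flip: diff_divide_distrib)
  qed
  moreover have "(\<lambda>n. dist (c (real n)) (c' (real n)) / real n - dist (d (real n)) (d' (real n)) / real n)
      \<longlonglongrightarrow> limit_slope c c' - limit_slope d d'"
    using limit_slope_tendsto[OF assms(1) rays(1,3) assms(4)]
      limit_slope_tendsto[OF assms(1) rays(2,4) assms(5)] by (rule tendsto_diff)
  ultimately show ?thesis using LIMSEQ_unique by fastforce
qed

lemma comparison_cos_rays_diagonal:
  assumes "geodesic_ray c" "geodesic_ray c'" "c 0 = p" "c' 0 = p" "t > 0"
  shows "comparison_cos p (c t) (c' t) = 1 - (dist (c t) (c' t) / t)\<^sup>2 / 2"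
  using geodesic_ray_dist[OF assms(1), of 0 t] geodesic_ray_dist[OF assms(2), of 0 t] assms(3-5)
  by (simp add: comparison_cos_def field_simps power2_eq_square)

text \<open>
  By monotonicity it suffices to look at the diagonal point with parameter \<open>max s t\<close>.
\<close>

lemma comparison_cos_ge_limit:
  fixes c c' :: "real \<Rightarrow> 'a::metric_space"
  assumes "CAT0 TYPE('a)" "geodesic_ray c" "geodesic_ray c'" "c 0 = p" "c' 0 = p" "0 < s" "0 < t"
  shows "1 - (limit_slope c c')\<^sup>2 / 2 \<le> comparison_cos p (c s) (c' t)"
proof -
  define m where "m = max s t"
  have m: "m > 0" "s \<le> m" "t \<le> m" using assms by (auto simp: m_def)
  have "dist (c m) (c' m) / m \<le> limit_slope c c'"
    using dist_le_limit_slope[OF assms(1-3), of m] assms(4,5) m by (simp add: pos_divide_le_eq)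
  then have "(dist (c m) (c' m) / m)\<^sup>2 \<le> (limit_slope c c')\<^sup>2" using m by (intro power_mono) auto
  then have "1 - (limit_slope c c')\<^sup>2 / 2 \<le> comparison_cos p (c m) (c' m)"
    using comparison_cos_rays_diagonal[OF assms(2-5) m(1)] by simp
  also have "\<dots> \<le> comparison_cos p (c s) (c' t)"
    using comparison_cos_rays_antimono[OF assms(1-5,6) m(2) assms(7) m(3)] .
  finally show ?thesis .
qed

text \<open>
  The limes superior is taken in the extended reals; two-sided bounds also make it finite, so that
  its conversion to a real is harmless.
\<close>

lemma alexandrov_angle_bounds:
  assumes "T > 0"
    "\<And>s t. \<lbrakk>0 < s; s < T; 0 < t; t < T\<rbrakk> \<Longrightarrow>
       l \<le> comparison_angle (c 0) (c s) (c' t) \<and> comparison_angle (c 0) (c s) (c' t) \<le> u"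
  shows "l \<le> alexandrov_angle c c'" "alexandrov_angle c c' \<le> u"
proof -
  let ?F = "at_right (0::real) \<times>\<^sub>F at_right (0::real)"
  let ?f = "\<lambda>(s, t). ereal (comparison_angle (c 0) (c s) (c' t))"
  have "\<forall>\<^sub>F s in at_right 0. 0 < s \<and> s < T"
    using assms(1) unfolding eventually_at_right_field by blast
  then have "\<forall>\<^sub>F x in ?F. (0 < fst x \<and> fst x < T) \<and> 0 < snd x \<and> snd x < T"
    by (intro eventually_prodI)
  then have "\<forall>\<^sub>F x in ?F. ereal l \<le> ?f x \<and> ?f x \<le> ereal u"
    by (rule eventually_mono) (use assms(2) in auto)
  then have ev: "\<forall>\<^sub>F x in ?F. ereal l \<le> ?f x" "\<forall>\<^sub>F x in ?F. ?f x \<le> ereal u"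
    by (auto elim: eventually_mono)
  have "ereal l \<le> Limsup ?F ?f"
    by (rule le_Limsup[OF _ ev(1)]) (simp add: prod_filter_eq_bot)
  moreover have "Limsup ?F ?f \<le> ereal u" by (rule Limsup_bounded[OF ev(2)])
  ultimately have "\<exists>r. Limsup ?F ?f = ereal r \<and> l \<le> r \<and> r \<le> u"
    by (cases "Limsup ?F ?f") auto
  then show "l \<le> alexandrov_angle c c'" "alexandrov_angle c c' \<le> u"
    unfolding alexandrov_angle_def by auto
qed

text \<open>
  The ray \<open>c''\<close> is the limit of segments from \<open>p = c T\<close> to \<open>c' n\<close>. By monotonicity the comparison
  angle at \<open>c 0\<close> of \<open>p\<close>, \<open>c' n\<close> is at least that of \<open>p\<close>, \<open>c' T\<close>, whose cosine is \<open>k\<close>; the law of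
  cosines then bounds the comparison angle at \<open>p\<close> of \<open>c 0\<close>, \<open>c' n\<close> from above by the angle with
  cosine \<open>- k\<close>. This passes to points of the backward ray and of \<open>c''\<close>, and
  \<open>comparison_cos_opposite\<close> turns it into a lower bound for the forward ray.
\<close>

lemma comparison_cos_along_ray:
  fixes c c' c'' :: "real \<Rightarrow> 'a::complete_space"
  assumes CAT0: "CAT0 TYPE('a)" and rays: "geodesic_ray c" "geodesic_ray c'" "c 0 = c' 0"
    and c'': "(c', c'') \<in> asymptotic" "c'' 0 = c T" and st: "0 < s" "s \<le> T" "0 < t"
  shows "comparison_cos (c T) (c (T + s)) (c'' t) \<le> comparison_cos (c 0) (c T) (c' T)"
proof -
  define b p k x where "b = c 0" and "p = c T" and "k = comparison_cos b (c T) (c' T)" and "x = c (T - s)"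
  obtain e \<sigma> where e: "(c', e) \<in> asymptotic" "e 0 = p"
    and lim: "\<And>t. t \<ge> 0 \<Longrightarrow> (\<lambda>n. \<sigma> n t) \<longlonglongrightarrow> e t"
    and \<sigma>: "\<And>n t. \<lbrakk>0 \<le> t; t \<le> dist p (c' (real n))\<rbrakk> \<Longrightarrow>
       dist p (\<sigma> n t) = t \<and> dist (\<sigma> n t) (c' (real n)) = dist p (c' (real n)) - t"
    by (rule asymptotic_ray_from[OF CAT0 rays(2), of p]) blast
  have "(c'', e) \<in> asymptotic" using asymptotic_trans[OF asymptotic_sym[OF c''(1)] e(1)] .
  then have "c'' = e" by (rule asymptotic_unique[OF CAT0]) (simp add: c''(2) e(2) p_def)
  have T: "T > 0" using st by linarith
  have bd: "dist b (c u) = u" "dist b (c' u) = u" if "u \<ge> 0" for u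
    using geodesic_ray_dist[OF rays(1), of 0 u] geodesic_ray_dist[OF rays(2), of 0 u] that rays(3)
    by (auto simp: b_def)
  have pd: "dist p x = s" "dist x b = T - s" "dist p b = T" "dist p (c (T + s)) = s"
    "dist x (c (T + s)) = 2 * s"
    using st geodesic_ray_dist[OF rays(1)] by (auto simp: p_def x_def b_def)
  have ed: "dist p (e t) = t"
    using geodesic_ray_dist[of e 0 t] asymptotic_rays[OF e(1)] e(2) st by simp
  have "b \<noteq> p" "b \<noteq> c' T" using pd(3) bd(2)[of T] T by auto
  then have k: "- 1 \<le> k" "k \<le> 1" using comparison_cos_bounds[of b p "c' T"] by (auto simp: k_def p_def)
  have key: "- k \<le> comparison_cos p x (\<sigma> n t)" if n: "T + t < real n" for n
  proof -
    define D where "D = dist p (c' n)"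
    have D: "\<bar>n - D\<bar> \<le> T"
      using dist_triangle[of p "c' n" b] dist_triangle[of b "c' n" p] pd(3) bd(2)[of n]
      by (simp add: D_def dist_commute)
    have pos: "D > t" "D > 0" using D n st by linarith+
    have "comparison_cos b p (c' n) \<le> k"
      unfolding k_def p_def b_def
      by (rule comparison_cos_rays_antimono[OF CAT0 rays(1,2) refl rays(3)[symmetric]])
        (use n T st in auto)
    then have 1: "T\<^sup>2 + (real n)\<^sup>2 - D\<^sup>2 \<le> k * (2 * T * n)"
      using pd(3) bd(2)[of n] n st T by (simp add: comparison_cos_def D_def dist_commute pos_divide_le_eq)
    have "- k * D \<le> T - n * k"
    proof -
      have "\<bar>k\<bar> \<le> 1" using k by linarith
      then have "\<bar>k\<bar> * \<bar>n - D\<bar> \<le> 1 * T" by (rule mult_mono) (use D in simp_all)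
      then have "k * (n - D) \<le> T" using abs_ge_self[of "k * (n - D)"] by (simp add: abs_mult)
      then show ?thesis by (simp add: algebra_simps)
    qed
    then have "- k * D * (2 * T) \<le> (T - n * k) * (2 * T)" using T by (intro mult_right_mono) auto
    also have "\<dots> \<le> T\<^sup>2 + D\<^sup>2 - (real n)\<^sup>2" using 1 by (simp add: power2_eq_square algebra_simps)
    finally have "- k \<le> (T\<^sup>2 + D\<^sup>2 - (real n)\<^sup>2) / (2 * T * D)"
      using pos T by (simp add: pos_le_divide_eq mult_ac)
    also have "\<dots> = comparison_cos p b (c' n)"
      using pd(3) bd(2)[of n] by (simp add: comparison_cos_def D_def)
    also have "\<dots> \<le> comparison_cos p x (\<sigma> n t)"
      using pd \<sigma>[of t n] pos st by (intro comparison_cos_antimono[OF CAT0]) (auto simp: D_def)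
    finally show ?thesis .
  qed
  have "(\<lambda>n. comparison_cos p x (\<sigma> n t)) \<longlonglongrightarrow> comparison_cos p x (e t)"
    unfolding comparison_cos_def
    by (intro tendsto_intros lim) (use st pd ed in auto)
  moreover have "\<forall>\<^sub>F n in sequentially. - k \<le> comparison_cos p x (\<sigma> n t)"
    using eventually_gt_at_top[of "nat \<lceil>T + t\<rceil>"] by eventually_elim (rule key, linarith)
  ultimately have "- k \<le> comparison_cos p x (e t)" by (rule tendsto_lowerbound) simp
  moreover have "comparison_cos p (c (T + s)) (e t) \<le> - comparison_cos p x (e t)"
    by (rule comparison_cos_opposite[OF CAT0, where s = s]) (use pd ed st in auto)
  ultimately show ?thesis using \<open>c'' = e\<close> by (simp add: p_def k_def b_def)
qed

section \<open>The angular distance as a limiting comparison angle\<close>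

lemma boundary_classD:
  assumes "\<xi> \<in> boundary_at_infinity"
  shows "c \<in> \<xi> \<Longrightarrow> geodesic_ray c"
    and "c \<in> \<xi> \<Longrightarrow> c' \<in> \<xi> \<Longrightarrow> (c, c') \<in> asymptotic"
    and "c \<in> \<xi> \<Longrightarrow> (c, c') \<in> asymptotic \<Longrightarrow> c' \<in> \<xi>"
proof -
  obtain d where d: "geodesic_ray d" "\<xi> = asymptotic `` {d}"
    using assms unfolding boundary_at_infinity_def by (auto elim!: quotientE)
  show "c \<in> \<xi> \<Longrightarrow> geodesic_ray c" using d(2) asymptotic_rays by blast
  show "c \<in> \<xi> \<Longrightarrow> c' \<in> \<xi> \<Longrightarrow> (c, c') \<in> asymptotic"
    using d(2) asymptotic_trans asymptotic_sym by blast
  show "c \<in> \<xi> \<Longrightarrow> (c, c') \<in> asymptotic \<Longrightarrow> c' \<in> \<xi>"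
    using d(2) asymptotic_trans by blast
qed

lemma asymptotic_class_in_boundary:
  "geodesic_ray c \<Longrightarrow> asymptotic `` {c} \<in> boundary_at_infinity"
  unfolding boundary_at_infinity_def by (auto intro: quotientI)

lemma ray_from_eqI:
  fixes c :: "real \<Rightarrow> 'a::metric_space"
  assumes "CAT0 TYPE('a)" "\<xi> \<in> boundary_at_infinity" "c \<in> \<xi>" "c 0 = p"
  shows "ray_from p \<xi> = c"
  unfolding ray_from_def
  by (rule the_equality)
    (use assms asymptotic_unique[OF assms(1)] boundary_classD(2)[OF assms(2)] in auto)

lemma ray_from:
  fixes p :: "'a::complete_space"
  assumes "CAT0 TYPE('a)" "\<xi> \<in> boundary_at_infinity"
  shows ray_from_in: "ray_from p \<xi> \<in> \<xi>" and ray_from_0: "ray_from p \<xi> 0 = p"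
proof -
  obtain d where d: "geodesic_ray d" "\<xi> = asymptotic `` {d}"
    using assms unfolding boundary_at_infinity_def by (auto elim!: quotientE)
  obtain c where "(d, c) \<in> asymptotic" "c 0 = p"
    by (rule asymptotic_ray_from[OF assms(1) d(1), of p]) blast
  then have "c \<in> \<xi>" "c 0 = p" using d(2) by auto
  with ray_from_eqI[OF assms this] show "ray_from p \<xi> \<in> \<xi>" "ray_from p \<xi> 0 = p" by auto
qed

lemma ray_from_ray:
  fixes p :: "'a::complete_space"
  assumes "CAT0 TYPE('a)" "\<xi> \<in> boundary_at_infinity"
  shows "geodesic_ray (ray_from p \<xi>)"
  using boundary_classD(1)[OF assms(2)] ray_from_in[OF assms] .

text \<open>
  A tail of a ray is asymptotic to the ray, so by uniqueness it is the ray of the class from its own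
  starting point.
\<close>

lemma ray_from_along:
  fixes c :: "real \<Rightarrow> 'a::metric_space"
  assumes "CAT0 TYPE('a)" "\<xi> \<in> boundary_at_infinity" "c \<in> \<xi>" "T \<ge> 0" "s \<ge> 0"
  shows "ray_from (c T) \<xi> s = c (T + s)"
proof -
  define d where "d = restrict (\<lambda>t. c (T + t)) {0..}"
  have c: "geodesic_ray c" using boundary_classD(1)[OF assms(2,3)] .
  have "geodesic_ray d" using geodesic_ray_dist[OF c] assms(4) by (auto simp: geodesic_ray_def d_def)
  moreover have "dist (c t) (d t) \<le> T" if "t \<ge> 0" for t
    using geodesic_ray_dist[OF c, of t "T + t"] that assms(4) by (simp add: d_def)
  ultimately have "d \<in> \<xi>"
    by (intro boundary_classD(3)[OF assms(2,3)] asymptoticI[OF c, where M = T])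
  then have "ray_from (c T) \<xi> = d" by (intro ray_from_eqI[OF assms(1,2)]) (simp_all add: d_def)
  then show ?thesis using assms(5) by (simp add: d_def)
qed

text \<open>
  The angle at the apex of an isosceles Euclidean triangle with two sides \<open>1\<close> and third side
  \<open>limit_slope c c'\<close>.
\<close>

definition limit_angle :: "(real \<Rightarrow> 'a::metric_space) \<Rightarrow> (real \<Rightarrow> 'a) \<Rightarrow> real" where
  "limit_angle c c' = arccos (1 - (limit_slope c c')\<^sup>2 / 2)"

lemma limit_cos_bounds:
  fixes c c' :: "real \<Rightarrow> 'a::metric_space"
  assumes "CAT0 TYPE('a)" "geodesic_ray c" "geodesic_ray c'" "c 0 = c' 0"
  shows "-1 \<le> 1 - (limit_slope c c')\<^sup>2 / 2" "1 - (limit_slope c c')\<^sup>2 / 2 \<le> 1"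
proof -
  have "(limit_slope c c')\<^sup>2 \<le> 2\<^sup>2" using limit_slope(3,4)[OF assms] by (intro power_mono) auto
  then show "-1 \<le> 1 - (limit_slope c c')\<^sup>2 / 2" by simp
qed simp

text \<open>
  This is \<open>2 sin (\<theta>/2) \<le> \<theta>\<close>: the chord of a unit circular arc is no longer than the arc.
\<close>

lemma limit_slope_le_angle:
  fixes c c' :: "real \<Rightarrow> 'a::metric_space"
  assumes "CAT0 TYPE('a)" "geodesic_ray c" "geodesic_ray c'" "c 0 = c' 0"
  shows "limit_slope c c' \<le> limit_angle c c'"
proof -
  define L \<theta> where "L = limit_slope c c'" and "\<theta> = limit_angle c c'"
  have \<theta>: "0 \<le> \<theta>" "\<theta> \<le> pi" "cos \<theta> = 1 - L\<^sup>2 / 2"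
    using limit_cos_bounds[OF assms] by (auto simp: \<theta>_def L_def limit_angle_def arccos_lbound arccos_ubound)
  have "cos \<theta> = 1 - 2 * (sin (\<theta> / 2))\<^sup>2" using cos_double_sin[of "\<theta> / 2"] by simp
  then have "L\<^sup>2 = (2 * sin (\<theta> / 2))\<^sup>2" using \<theta>(3) by (simp add: power_mult_distrib)
  moreover have "0 \<le> sin (\<theta> / 2)" using \<theta> by (intro sin_ge_zero) auto
  moreover have "0 \<le> L" using limit_slope(3)[OF assms] by (simp add: L_def)
  ultimately have "L = 2 * sin (\<theta> / 2)" by - (rule power2_eq_imp_eq, simp_all)
  also have "\<dots> \<le> 2 * (\<theta> / 2)" using \<theta>(1) by (intro mult_left_mono sin_x_le_x) auto
  finally show ?thesis by (simp add: L_def \<theta>_def)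
qed

text \<open>
  Comparison angles at \<open>p\<close> are bounded by their limit, which is the same at \<open>p\<close> and at \<open>b\<close> because
  asymptotic rays have the same limiting slope.
\<close>

lemma angle_at_le_limit_angle:
  fixes p b :: "'a::complete_space"
  assumes CAT0: "CAT0 TYPE('a)" and bd: "\<xi> \<in> boundary_at_infinity" "\<zeta> \<in> boundary_at_infinity"
  shows "angle_at p \<xi> \<zeta> \<le> limit_angle (ray_from b \<xi>) (ray_from b \<zeta>)"
proof -
  let ?c = "ray_from p \<xi>" and ?c' = "ray_from p \<zeta>"
  note rays = ray_from_ray[OF CAT0 bd(1), of p] ray_from_ray[OF CAT0 bd(2), of p]
  note start = ray_from_0[OF CAT0 bd(1), of p] ray_from_0[OF CAT0 bd(2), of p]
  have slope: "limit_slope ?c ?c' = limit_slope (ray_from b \<xi>) (ray_from b \<zeta>)"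
    using boundary_classD(2)[OF bd(1)] boundary_classD(2)[OF bd(2)] ray_from_in[OF CAT0] bd
    by (intro limit_slope_asymptotic[OF CAT0]) (auto simp: ray_from_0[OF CAT0])
  have "0 \<le> comparison_angle (?c 0) (?c s) (?c' t) \<and>
      comparison_angle (?c 0) (?c s) (?c' t) \<le> limit_angle ?c ?c'" if "s > 0" "t > 0" for s t
  proof -
    have ne: "p \<noteq> ?c s" "p \<noteq> ?c' t"
      using geodesic_ray_dist[OF rays(1), of 0 s] geodesic_ray_dist[OF rays(2), of 0 t] start that by auto
    have "1 - (limit_slope ?c ?c')\<^sup>2 / 2 \<le> comparison_cos p (?c s) (?c' t)"
      by (rule comparison_cos_ge_limit[OF CAT0 rays start that])
    then show ?thesis
      using comparison_cos_bounds[OF ne] limit_cos_bounds[OF CAT0 rays] start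
      unfolding start comparison_angle_eq_arccos[OF ne] limit_angle_def
      by (auto intro!: arccos_le_arccos arccos_lbound)
  qed
  then have "angle_at p \<xi> \<zeta> \<le> limit_angle ?c ?c'"
    unfolding angle_at_def by (intro alexandrov_angle_bounds(2)[of 1 0]) auto
  then show ?thesis by (simp add: limit_angle_def slope)
qed

text \<open>
  The rays from \<open>c T\<close> are the tail of \<open>c\<close> and an asymptotic ray, so the cosine bound
  \<open>comparison_cos_along_ray\<close> applies to all small triangles in the Alexandrov angle at \<open>c T\<close>.
\<close>

lemma angle_at_far_point_ge:
  fixes b :: "'a::complete_space"
  assumes CAT0: "CAT0 TYPE('a)" and bd: "\<xi> \<in> boundary_at_infinity" "\<zeta> \<in> boundary_at_infinity"
    and T: "T > 0"
  shows "arccos (comparison_cos b (ray_from b \<xi> T) (ray_from b \<zeta> T))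
    \<le> angle_at (ray_from b \<xi> T) \<xi> \<zeta>"
proof -
  define c c' p where "c = ray_from b \<xi>" and "c' = ray_from b \<zeta>" and "p = c T"
  define d d' where "d = ray_from p \<xi>" and "d' = ray_from p \<zeta>"
  have c: "c \<in> \<xi>" "c' \<in> \<zeta>" "c 0 = b" "c' 0 = b"
    and d: "d \<in> \<xi>" "d' \<in> \<zeta>" "d 0 = p" "d' 0 = p"
    using ray_from_in[OF CAT0] ray_from_0[OF CAT0] bd by (auto simp: c_def c'_def d_def d'_def)
  have rays: "geodesic_ray c" "geodesic_ray c'" "geodesic_ray d" "geodesic_ray d'"
    using boundary_classD(1)[OF bd(1)] boundary_classD(1)[OF bd(2)] c d by auto
  have "arccos (comparison_cos b (c T) (c' T)) \<le> comparison_angle (d 0) (d s) (d' t) \<and>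
      comparison_angle (d 0) (d s) (d' t) \<le> pi" if st: "0 < s" "s < T" "0 < t" "t < T" for s t
  proof -
    have ne: "p \<noteq> d s" "p \<noteq> d' t"
      using geodesic_ray_dist[OF rays(3), of 0 s] geodesic_ray_dist[OF rays(4), of 0 t] d st by auto
    have ne': "b \<noteq> c T" "b \<noteq> c' T"
      using geodesic_ray_dist[OF rays(1), of 0 T] geodesic_ray_dist[OF rays(2), of 0 T] c T by auto
    have "d s = c (T + s)"
      unfolding d_def p_def using ray_from_along[OF CAT0 bd(1) c(1)] T st by simp
    moreover have "comparison_cos (c T) (c (T + s)) (d' t) \<le> comparison_cos (c 0) (c T) (c' T)"
      using c d rays st boundary_classD(2)[OF bd(2)]
      by (intro comparison_cos_along_ray[OF CAT0]) (auto simp: p_def)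
    ultimately have "comparison_cos p (d s) (d' t) \<le> comparison_cos b (c T) (c' T)"
      by (simp add: p_def c(3))
    then show ?thesis
      using comparison_cos_bounds[OF ne] comparison_cos_bounds[OF ne']
      unfolding d(3) comparison_angle_eq_arccos[OF ne]
      by (auto intro!: arccos_le_arccos arccos_ubound)
  qed
  then have "arccos (comparison_cos b (c T) (c' T)) \<le> alexandrov_angle d d'"
    by (intro alexandrov_angle_bounds(1)[OF T, where u = pi])
  then show ?thesis
    by (simp add: angle_at_def c_def c'_def d_def d'_def p_def)
qed

text \<open>
  The angles at the points \<open>c n\<close> bound the supremum from below by comparison angles at \<open>b\<close> that
  converge to the limiting angle.
\<close>

lemma angular_dist_eq_limit_angle:
  fixes b :: "'a::complete_space"
  assumes CAT0: "CAT0 TYPE('a)" and bd: "\<xi> \<in> boundary_at_infinity" "\<zeta> \<in> boundary_at_infinity"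
  shows "angular_dist \<xi> \<zeta> = limit_angle (ray_from b \<xi>) (ray_from b \<zeta>)"
proof (rule antisym)
  show "angular_dist \<xi> \<zeta> \<le> limit_angle (ray_from b \<xi>) (ray_from b \<zeta>)"
    unfolding angular_dist_def by (intro cSUP_least angle_at_le_limit_angle[OF assms]) simp
  define c c' where "c = ray_from b \<xi>" and "c' = ray_from b \<zeta>"
  define X where "X n = dist (c (real n)) (c' (real n)) / real n" for n
  have rays: "geodesic_ray c" "geodesic_ray c'" and start: "c 0 = b" "c' 0 = b"
    using ray_from_ray[OF CAT0] ray_from_0[OF CAT0] bd by (auto simp: c_def c'_def)
  have cos: "1 - (X n)\<^sup>2 / 2 = comparison_cos b (c n) (c' n)" if "n > 0" for n
    using comparison_cos_rays_diagonal[OF rays start] that by (simp add: X_def)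
  have bounds: "1 - (X n)\<^sup>2 / 2 \<in> {-1..1}" if n: "n > 0" for n
  proof -
    have "b \<noteq> c n" "b \<noteq> c' n"
      using geodesic_ray_dist[OF rays(1), of 0 n] geodesic_ray_dist[OF rays(2), of 0 n] start n by auto
    from comparison_cos_bounds[OF this] show ?thesis unfolding cos[OF n] by simp
  qed
  have "X \<longlonglongrightarrow> limit_slope c c'"
    using limit_slope_tendsto[OF CAT0 rays] start by (simp add: X_def[abs_def])
  then have "(\<lambda>n. 1 - (X n)\<^sup>2 / 2) \<longlonglongrightarrow> 1 - (limit_slope c c')\<^sup>2 / 2" by (intro tendsto_intros) auto
  then have "(\<lambda>n. arccos (1 - (X n)\<^sup>2 / 2)) \<longlonglongrightarrow> limit_angle c c'"
    unfolding limit_angle_def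
  proof (rule continuous_on_tendsto_compose[OF continuous_on_arccos'])
    show "1 - (limit_slope c c')\<^sup>2 / 2 \<in> {-1..1}"
      using limit_cos_bounds[OF CAT0 rays] start by simp
    show "\<forall>\<^sub>F n in sequentially. 1 - (X n)\<^sup>2 / 2 \<in> {-1..1}"
      using eventually_gt_at_top[of 0] by eventually_elim (rule bounds)
  qed
  moreover have "arccos (1 - (X n)\<^sup>2 / 2) \<le> angular_dist \<xi> \<zeta>" if n: "n > 0" for n
  proof -
    have "arccos (1 - (X n)\<^sup>2 / 2) \<le> angle_at (c n) \<xi> \<zeta>"
      unfolding cos[OF n] c_def c'_def using n by (intro angle_at_far_point_ge[OF assms]) simp
    also have "\<dots> \<le> angular_dist \<xi> \<zeta>"
      unfolding angular_dist_def
      by (intro cSUP_upper bdd_aboveI2[OF angle_at_le_limit_angle[OF assms]]) simp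
    finally show ?thesis .
  qed
  then have "\<forall>\<^sub>F n in sequentially. arccos (1 - (X n)\<^sup>2 / 2) \<le> angular_dist \<xi> \<zeta>"
    by (rule eventually_mono[OF eventually_gt_at_top])
  ultimately show "limit_angle (ray_from b \<xi>) (ray_from b \<zeta>) \<le> angular_dist \<xi> \<zeta>"
    unfolding c_def[symmetric] c'_def[symmetric] by (rule tendsto_upperbound) simp
qed

section \<open>Linear distance of rays\<close>

lemma ray_unbounded:
  assumes "geodesic_ray c"
  shows "c ` {0..} \<in> unbounded_sets"
proof -
  have "\<not> bounded (c ` {0..})"
  proof
    assume "bounded (c ` {0..})"
    then obtain e where e: "\<And>t. t \<ge> 0 \<Longrightarrow> dist (c 0) (c t) \<le> e"
      using bounded_any_center[of _ "c 0"] by (metis atLeast_iff image_eqI)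
    show False
      using e[of "\<bar>e\<bar> + 1"] geodesic_ray_dist[OF assms, of 0 "\<bar>e\<bar> + 1"] by simp
  qed
  then show ?thesis by (simp add: unbounded_sets_def)
qed

lemma s_dist_rays_le:
  assumes rays: "geodesic_ray c" "geodesic_ray c'" and "c 0 = b" "c' 0 = b" "e \<ge> 0"
    and close: "\<And>t. t \<ge> 0 \<Longrightarrow> dist (c t) (c' t) \<le> e * t"
  shows "s_dist b (c ` {0..}) (c' ` {0..}) \<le> e"
proof -
  have d: "dist b (c t) = t" "dist b (c' t) = t" if "t \<ge> 0" for t
    using geodesic_ray_dist[OF rays(1), of 0 t] geodesic_ray_dist[OF rays(2), of 0 t] assms(3,4) that
    by auto
  have "s_plus b (c ` {0..}) (c' ` {0..}) \<le> e"
    by (rule s_plus_le[OF assms(5), of 0]) (use close d in \<open>auto simp: linear_nbhd_def\<close>)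
  moreover have "s_plus b (c' ` {0..}) (c ` {0..}) \<le> e"
    by (rule s_plus_le[OF assms(5), of 0])
      (use close d in \<open>auto simp: linear_nbhd_def dist_commute\<close>)
  ultimately show ?thesis by (simp add: s_dist_def)
qed

lemma asymptotic_imp_linear_equiv:
  assumes "(c, c') \<in> asymptotic"
  shows "(c ` {0..}, c' ` {0..}) \<in> linear_equiv b"
proof -
  obtain M where M: "M \<ge> 0" "\<And>t. t \<ge> 0 \<Longrightarrow> dist (c t) (c' t) \<le> M"
    using asymptoticD[OF assms] by blast
  have unb: "c ` {0..} \<in> unbounded_sets" "c' ` {0..} \<in> unbounded_sets"
    using asymptotic_rays[OF assms] ray_unbounded by auto
  have "s_plus b (c ` {0..}) (c' ` {0..}) \<le> 0"
    by (rule s_plus_le[of 0 M]) (use M in \<open>auto simp: linear_nbhd_def\<close>)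
  moreover have "s_plus b (c' ` {0..}) (c ` {0..}) \<le> 0"
    by (rule s_plus_le[of 0 M]) (use M in \<open>auto simp: linear_nbhd_def dist_commute\<close>)
  ultimately have "s_dist b (c ` {0..}) (c' ` {0..}) = 0"
    using s_dist_bounds(1)[OF unb, of b] by (simp add: s_dist_def)
  with unb show ?thesis by (simp add: linear_equiv_def)
qed

text \<open>
  Jordan's inequality with the constant \<open>1 / \<pi>\<close> in place of the sharp \<open>2 / \<pi>\<close>. Below \<open>\<pi>/3\<close> the
  mean value theorem suffices since the cosine is at least \<open>1/2\<close>; above, \<open>sin x \<ge> 1/2\<close>.
\<close>

lemma angle_le_pi_mult_sin:
  assumes "0 \<le> x" "x \<le> pi / 2"
  shows "x \<le> pi * sin x"
proof (cases "x \<le> pi / 3")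
  case True
  have "x = 0 \<or> (\<exists>z. 0 < z \<and> z < x \<and> sin x - sin 0 = (x - 0) * cos z)"
  proof (cases "x = 0")
    case False
    then have "0 < x" using assms by simp
    then show ?thesis by (intro disjI2 MVT2) (auto intro!: derivative_eq_intros)
  qed simp
  then show ?thesis
  proof
    assume "\<exists>z. 0 < z \<and> z < x \<and> sin x - sin 0 = (x - 0) * cos z"
    then obtain z where z: "0 < z" "z < x" "sin x = x * cos z" by auto
    have "cos (pi / 3) \<le> cos z" using z True assms by (intro cos_monotone_0_pi_le) auto
    then have "1 \<le> pi * cos z" using mult_mono[of 2 pi "1/2" "cos z"] pi_ge_two by (simp add: cos_60)
    then show ?thesis using mult_left_mono[of 1 "pi * cos z" x] assms z(3) by (simp add: mult_ac)
  qed simp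
next
  case False
  have "sin (pi / 6) \<le> sin x" using False assms by (intro sin_monotone_2pi_le) auto
  then have "pi * (1 / 2) \<le> pi * sin x" by (intro mult_left_mono) (auto simp: sin_30)
  with assms(2) show ?thesis by linarith
qed

text \<open>
  A point \<open>c' t\<close> has a partner \<open>c u\<close> with \<open>dist (c u) (c' t) \<le> \<alpha> * u + a\<close>, and \<open>u\<close> is large when
  \<open>t\<close> is, so the additive constant is absorbed by passing from \<open>\<alpha>\<close> to \<open>\<beta>\<close>. In a Euclidean triangle
  with sides \<open>u\<close>, \<open>t\<close> enclosing an angle and third side at most \<open>\<beta> * u\<close>, the sine of that angle
  is at most \<open>\<beta>\<close> and the angle is acute. Far out, comparison angles are close to the limiting one.
\<close>

lemma limit_cos_ge_of_linear_nbhd: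
  fixes c c' :: "real \<Rightarrow> 'a::metric_space"
  assumes CAT0: "CAT0 TYPE('a)" and rays: "geodesic_ray c" "geodesic_ray c'" and start: "c 0 = b" "c' 0 = b"
    and \<alpha>: "0 \<le> \<alpha>" "\<alpha> < \<beta>" "\<beta> < 1" "a \<ge> 0" and sub: "c' ` {0..} \<subseteq> linear_nbhd b \<alpha> (c ` {0..}) a"
  shows "sqrt (1 - \<beta>\<^sup>2) \<le> 1 - (limit_slope c c')\<^sup>2 / 2"
proof (rule field_le_epsilon)
  fix e :: real assume e: "e > 0"
  define k where "k = 1 - (limit_slope c c')\<^sup>2 / 2"
  have d: "dist b (c t) = t" "dist b (c' t) = t" if "t \<ge> 0" for t
    using geodesic_ray_dist[OF rays(1), of 0 t] geodesic_ray_dist[OF rays(2), of 0 t] start that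
    by auto
  have "(\<lambda>n. 1 - (dist (c (real n)) (c' (real n)) / real n)\<^sup>2 / 2) \<longlonglongrightarrow> k"
    unfolding k_def using limit_slope_tendsto[OF CAT0 rays] start by (intro tendsto_intros) auto
  then have "\<forall>\<^sub>F n in sequentially. 1 - (dist (c (real n)) (c' (real n)) / real n)\<^sup>2 / 2 < k + e"
    by (rule order_tendstoD) (use e in simp)
  then have "\<forall>\<^sub>F n in sequentially. 0 < n \<and> 1 - (dist (c (real n)) (c' (real n)) / real n)\<^sup>2 / 2 < k + e"
    using eventually_gt_at_top[of 0] by eventually_elim simp
  then obtain N :: nat where N: "0 < N"
    "1 - (dist (c (real N)) (c' (real N)) / real N)\<^sup>2 / 2 < k + e"
    using eventually_happens'[OF sequentially_bot] by blast
  \<comment> \<open>Beyond \<open>w\<close> the constant \<open>a\<close> is at most \<open>(\<beta> - \<alpha>) * u\<close>.\<close>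
  define w where "w = a / (\<beta> - \<alpha>)"
  have w: "w \<ge> 0" "a = w * (\<beta> - \<alpha>)" using \<alpha> by (simp_all add: w_def)
  \<comment> \<open>The partner of \<open>c' t\<close> satisfies \<open>t \<le> 2 * u + a\<close>, so this choice makes \<open>u\<close> at least \<open>N + w\<close>.\<close>
  define t where "t = a + 2 * (N + w)"
  have t: "t \<ge> N" "t > 0" using N(1) w(1) \<alpha>(4) by (auto simp: t_def)
  have "c' t \<in> linear_nbhd b \<alpha> (c ` {0..}) a" using sub t by auto
  then obtain u where u: "u \<ge> 0" "dist (c u) (c' t) \<le> \<alpha> * u + a"
    using d by (auto simp: linear_nbhd_def)
  define v where "v = \<alpha> * u"
  have "t \<le> u + (v + a)"
    using d[of u] d[of t] dist_triangle[of b "c' t" "c u"] u t(2) by (simp add: v_def)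
  moreover have "v \<le> u" unfolding v_def using \<alpha> u(1) by (intro mult_left_le_one_le) auto
  ultimately have u': "N + w \<le> u" unfolding t_def by argo
  have uN: "N \<le> u" using u' w(1) by linarith
  have u0: "u > 0" using uN N(1) by simp
  have "w \<le> u" using u' by linarith
  then have "a \<le> u * (\<beta> - \<alpha>)" unfolding w(2) using \<alpha>(2) by (intro mult_right_mono) auto
  then have "dist (c u) (c' t) \<le> \<beta> * u" using u(2) by (simp add: right_diff_distrib mult.commute)
  then have dist: "(dist (c u) (c' t))\<^sup>2 \<le> (\<beta> * u)\<^sup>2" by (rule power_mono) simp
  define r where "r = sqrt (1 - \<beta>\<^sup>2)"
  have "\<beta>\<^sup>2 \<le> 1" using \<alpha> by (simp add: power_le_one)
  then have r: "r\<^sup>2 = 1 - \<beta>\<^sup>2" by (simp add: r_def)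
  have "0 \<le> (r * u - t)\<^sup>2" by simp
  also have "\<dots> = r\<^sup>2 * u\<^sup>2 + t\<^sup>2 - r * (2 * u * t)" by (simp add: power2_eq_square algebra_simps)
  also have "\<dots> \<le> u\<^sup>2 + t\<^sup>2 - (dist (c u) (c' t))\<^sup>2 - r * (2 * u * t)"
  proof -
    have "r\<^sup>2 * u\<^sup>2 = u\<^sup>2 - (\<beta> * u)\<^sup>2"
      unfolding r by (simp add: power_mult_distrib left_diff_distrib)
    with dist show ?thesis by linarith
  qed
  finally have "r \<le> (u\<^sup>2 + t\<^sup>2 - (dist (c u) (c' t))\<^sup>2) / (2 * u * t)"
    by (subst pos_le_divide_eq) (use u0 t(2) in simp_all)
  also have "\<dots> = comparison_cos b (c u) (c' t)" using d[of u] d[of t] u(1) t(2) by (simp add: comparison_cos_def)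
  also have "\<dots> \<le> comparison_cos b (c N) (c' N)"
    using N(1) uN t by (intro comparison_cos_rays_antimono[OF CAT0 rays start]) auto
  also have "\<dots> = 1 - (dist (c (real N)) (c' (real N)) / real N)\<^sup>2 / 2"
    using N(1) by (intro comparison_cos_rays_diagonal[OF rays start]) simp
  also have "\<dots> < k + e" by (rule N(2))
  finally show "sqrt (1 - \<beta>\<^sup>2) \<le> 1 - (limit_slope c c')\<^sup>2 / 2 + e" by (simp add: r_def k_def)
qed

text \<open>
  If \<open>s_plus\<close> is at least \<open>1\<close>, the bound is trivial because angles do not exceed \<open>\<pi>\<close>. Otherwise
  every \<open>\<beta>\<close> between \<open>s_plus\<close> and \<open>1\<close> bounds the sine of the limiting angle.
\<close>

lemma limit_angle_le_s_plus:
  fixes c c' :: "real \<Rightarrow> 'a::metric_space"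
  assumes CAT0: "CAT0 TYPE('a)" and rays: "geodesic_ray c" "geodesic_ray c'" and start: "c 0 = b" "c' 0 = b"
  shows "limit_angle c c' \<le> pi * s_plus b (c ` {0..}) (c' ` {0..})"
proof -
  let ?s = "s_plus b (c ` {0..}) (c' ` {0..})"
  have s: "0 \<le> ?s" by (rule s_plus_ge_0[OF ray_unbounded[OF rays(1)]])
  have k: "-1 \<le> 1 - (limit_slope c c')\<^sup>2 / 2" "1 - (limit_slope c c')\<^sup>2 / 2 \<le> 1"
    using limit_cos_bounds[OF CAT0 rays] start by auto
  show ?thesis
  proof (cases "?s < 1")
    case True
    have "limit_angle c c' / pi \<le> ?s"
    proof (rule dense_ge_bounded[OF True])
      fix \<beta> assume \<beta>: "?s < \<beta>" "\<beta> < 1"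
      obtain \<alpha> a where \<alpha>: "0 \<le> \<alpha>" "\<alpha> < \<beta>" "a \<ge> 0" "c' ` {0..} \<subseteq> linear_nbhd b \<alpha> (c ` {0..}) a"
        by (rule s_plus_less[OF ray_unbounded[OF rays(1)] \<beta>(1)])
      have "\<beta>\<^sup>2 \<le> 1" using \<beta> s by (simp add: power_le_one)
      then have r: "0 \<le> sqrt (1 - \<beta>\<^sup>2)" "sqrt (1 - \<beta>\<^sup>2) \<le> 1" by auto
      have "sqrt (1 - \<beta>\<^sup>2) \<le> 1 - (limit_slope c c')\<^sup>2 / 2"
        by (rule limit_cos_ge_of_linear_nbhd[OF CAT0 rays start \<alpha>(1,2) \<beta>(2) \<alpha>(3,4)])
      moreover have "- 1 \<le> sqrt (1 - \<beta>\<^sup>2)" using r(1) by linarith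
      ultimately have "limit_angle c c' \<le> arccos (sqrt (1 - \<beta>\<^sup>2))"
        unfolding limit_angle_def using k(2) by (intro arccos_le_arccos)
      also have "\<dots> \<le> pi * sin (arccos (sqrt (1 - \<beta>\<^sup>2)))"
        using \<open>- 1 \<le> sqrt (1 - \<beta>\<^sup>2)\<close>
        by (rule angle_le_pi_mult_sin[OF arccos_lbound[OF _ r(2)] arccos_le_pi2[OF r]])
      also have "\<dots> = pi * \<beta>"
      proof -
        have "sin (arccos (sqrt (1 - \<beta>\<^sup>2))) = sqrt (1 - (sqrt (1 - \<beta>\<^sup>2))\<^sup>2)"
          by (rule sin_arccos) (use r \<open>- 1 \<le> sqrt (1 - \<beta>\<^sup>2)\<close> in auto)
        also have "\<dots> = \<beta>" using \<open>\<beta>\<^sup>2 \<le> 1\<close> \<beta>(1) s by simp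
        finally show ?thesis by simp
      qed
      finally show "limit_angle c c' / pi \<le> \<beta>" by (simp add: pos_divide_le_eq mult.commute)
    qed
    then show ?thesis by (simp add: pos_divide_le_eq mult.commute)
  next
    case False
    have "limit_angle c c' \<le> pi * 1" unfolding limit_angle_def using k by (simp add: arccos_ubound)
    also have "\<dots> \<le> pi * ?s" using False by (intro mult_left_mono) auto
    finally show ?thesis .
  qed
qed

lemma limit_angle_le_s_dist:
  fixes c c' :: "real \<Rightarrow> 'a::metric_space"
  assumes "CAT0 TYPE('a)" "geodesic_ray c" "geodesic_ray c'" "c 0 = b" "c' 0 = b"
  shows "limit_angle c c' \<le> pi * s_dist b (c ` {0..}) (c' ` {0..})"
  by (rule order_trans[OF limit_angle_le_s_plus[OF assms]]) (simp add: s_dist_def)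

lemma s_dist_le_limit_angle:
  fixes c c' :: "real \<Rightarrow> 'a::metric_space"
  assumes "CAT0 TYPE('a)" "geodesic_ray c" "geodesic_ray c'" "c 0 = b" "c' 0 = b"
  shows "s_dist b (c ` {0..}) (c' ` {0..}) \<le> limit_angle c c'"
proof -
  have start: "c 0 = c' 0" using assms by simp
  note L = dist_le_limit_slope[OF assms(1-3) start] limit_slope_ge_0[OF assms(1-3) start]
    limit_slope_le_angle[OF assms(1-3) start]
  show ?thesis by (rule order_trans[OF s_dist_rays_le[OF assms(2-5) L(2,1)] L(3)])
qed

text \<open>
  The quantitative form of injectivity: linear distance controls the rays pointwise.
\<close>

lemma dist_rays_le_s_dist:
  fixes c c' :: "real \<Rightarrow> 'a::metric_space"
  assumes "CAT0 TYPE('a)" "geodesic_ray c" "geodesic_ray c'" "c 0 = b" "c' 0 = b" "t \<ge> 0"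
  shows "dist (c t) (c' t) \<le> pi * s_dist b (c ` {0..}) (c' ` {0..}) * t"
proof -
  have start: "c 0 = c' 0" using assms by simp
  have "dist (c t) (c' t) \<le> limit_slope c c' * t"
    by (rule dist_le_limit_slope[OF assms(1-3) start assms(6)])
  also have "\<dots> \<le> pi * s_dist b (c ` {0..}) (c' ` {0..}) * t"
    using limit_slope_le_angle[OF assms(1-3) start] limit_angle_le_s_dist[OF assms(1-5)] assms(6)
    by (intro mult_right_mono) auto
  finally show ?thesis .
qed

lemma class_dist_square:
  assumes "R \<in> unbounded_sets" "S \<in> unbounded_sets"
  shows "(class_dist b (linear_class b R) (linear_class b S))\<^sup>2 = s_dist b R S"
  using assms s_dist_bounds(1)[OF assms, of b] by (simp add: class_dist_eq t_dist_def)

lemma linear_class_eq_iff: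
  assumes "R \<in> unbounded_sets" "S \<in> unbounded_sets"
  shows "linear_class b R = linear_class b S \<longleftrightarrow> s_dist b R S = 0"
  using eq_equiv_class_iff[OF equiv_linear_equiv assms, of b] assms
  by (simp add: linear_class_def linear_equiv_def)

lemma ray_class_in:
  assumes "geodesic_ray c"
  shows "linear_class b (c ` {0..}) \<in> ray_classes b"
proof -
  have u: "c ` {0..} \<in> unbounded_sets" by (rule ray_unbounded[OF assms])
  then have "c ` {0..} \<in> linear_class b (c ` {0..})"
    using equiv_class_self[OF equiv_linear_equiv] by (simp add: linear_class_def)
  moreover have "c ` {0..} \<in> rays" using assms by (auto simp: rays_def)
  moreover have "linear_class b (c ` {0..}) \<in> linear_classes b"
    using u by (auto simp: linear_classes_def linear_class_def intro: quotientI)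
  ultimately show ?thesis by (auto simp: ray_classes_def)
qed

lemma ray_classesE:
  assumes "A \<in> ray_classes b"
  obtains c where "geodesic_ray c" "A = linear_class b (c ` {0..})"
proof -
  obtain c where c: "geodesic_ray c" "c ` {0..} \<in> A" "A \<in> linear_classes b"
    using assms by (auto simp: ray_classes_def rays_def)
  then obtain R where R: "R \<in> unbounded_sets" "A = linear_class b R"
    by (auto simp: linear_classes_def linear_class_def elim!: quotientE)
  have "s_dist b R (c ` {0..}) = 0" using c(2) R(2) by (simp add: linear_class_def linear_equiv_def)
  then have "A = linear_class b (c ` {0..})"
    using linear_class_eq_iff[OF R(1) ray_unbounded[OF c(1)]] R(2) by simp
  with c(1) show ?thesis by (rule that)
qed

section \<open>Limits of rays and the boundary map\<close>

text \<open>
  Small linear distance gives \<open>dist (c m t) (c n t) \<le> e * t\<close>, so the rays converge locally uniformly; the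
  same linear bound survives in the limit and controls the linear distance to the limit ray.
\<close>

lemma Cauchy_rays_converge:
  fixes c :: "nat \<Rightarrow> real \<Rightarrow> 'a::complete_space"
  assumes CAT0: "CAT0 TYPE('a)" and rays: "\<And>n. geodesic_ray (c n)" "\<And>n. c n 0 = b"
    and Cauchy: "\<And>e. e > 0 \<Longrightarrow>
      \<exists>N. \<forall>m\<ge>N. \<forall>n\<ge>N. s_dist b (c m ` {0..}) (c n ` {0..}) < e"
  obtains d where "geodesic_ray d" "d 0 = b"
    "(\<lambda>n. s_dist b (c n ` {0..}) (d ` {0..})) \<longlonglongrightarrow> 0"
proof -
  have close: "\<exists>N. \<forall>m\<ge>N. \<forall>n\<ge>N. \<forall>t\<ge>0. dist (c m t) (c n t) \<le> e * t" if e: "e > 0" for e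
  proof -
    obtain N where N: "\<And>m n. \<lbrakk>m \<ge> N; n \<ge> N\<rbrakk> \<Longrightarrow> s_dist b (c m ` {0..}) (c n ` {0..}) < e / pi"
      using Cauchy[of "e / pi"] e by auto
    have "dist (c m t) (c n t) \<le> e * t" if "m \<ge> N" "n \<ge> N" "t \<ge> 0" for m n t
    proof -
      have "dist (c m t) (c n t) \<le> pi * s_dist b (c m ` {0..}) (c n ` {0..}) * t"
        by (rule dist_rays_le_s_dist[OF CAT0 rays(1,1,2,2) that(3)])
      also have "\<dots> \<le> e * t"
        using N[OF that(1,2)] that(3) by (intro mult_right_mono) (simp_all add: pos_less_divide_eq mult.commute)
      finally show ?thesis .
    qed
    then show ?thesis by blast
  qed
  have "convergent (\<lambda>n. c n t)" if t: "t \<ge> 0" for t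
  proof (rule Cauchy_convergent, rule metric_CauchyI)
    fix e :: real assume e: "e > 0"
    define e' where "e' = e / (t + 1)"
    have e': "e' > 0" "e' * t < e" using e t by (simp_all add: e'_def field_simps)
    obtain N where "\<forall>m\<ge>N. \<forall>n\<ge>N. \<forall>t\<ge>0. dist (c m t) (c n t) \<le> e' * t" using close[OF e'(1)] by blast
    then show "\<exists>N. \<forall>m\<ge>N. \<forall>n\<ge>N. dist (c m t) (c n t) < e"
      using t e'(2) by (meson order_le_less_trans)
  qed
  then have "(\<lambda>n. c n t) \<longlonglongrightarrow> lim (\<lambda>n. c n t)" if "t \<ge> 0" for t
    using that by (simp add: convergent_LIMSEQ_iff)
  moreover define d where "d = restrict (\<lambda>t. lim (\<lambda>n. c n t)) {0..}"
  ultimately have lim: "(\<lambda>n. c n t) \<longlonglongrightarrow> d t" if "t \<ge> 0" for t using that by simp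
  have "dist (d s) (d t) = \<bar>s - t\<bar>" if "s \<ge> 0" "t \<ge> 0" for s t
    using tendsto_dist[OF lim[OF that(1)] lim[OF that(2)]] geodesic_ray_dist[OF rays(1) that]
      by (simp add: LIMSEQ_const_iff)
  then have d: "geodesic_ray d" by (auto simp: geodesic_ray_def d_def)
  have d0: "d 0 = b" using lim[of 0] rays(2) by (simp add: LIMSEQ_const_iff)
  have "(\<lambda>n. s_dist b (c n ` {0..}) (d ` {0..})) \<longlonglongrightarrow> 0"
  proof (rule metric_LIMSEQ_I)
    fix e :: real assume e: "e > 0"
    obtain N where N: "\<forall>m\<ge>N. \<forall>n\<ge>N. \<forall>t\<ge>0. dist (c m t) (c n t) \<le> e / 2 * t"
      using close[of "e / 2"] e by auto
    have "dist (s_dist b (c n ` {0..}) (d ` {0..})) 0 < e" if n: "n \<ge> N" for n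
    proof -
      have "s_dist b (c n ` {0..}) (d ` {0..}) \<le> e / 2"
      proof (rule s_dist_rays_le[OF rays(1) d rays(2) d0])
        fix t :: real assume t: "t \<ge> 0"
        show "dist (c n t) (d t) \<le> e / 2 * t"
        proof (rule tendsto_upperbound)
          show "(\<lambda>m. dist (c n t) (c m t)) \<longlonglongrightarrow> dist (c n t) (d t)"
            by (intro tendsto_dist tendsto_const lim t)
          show "\<forall>\<^sub>F m in sequentially. dist (c n t) (c m t) \<le> e / 2 * t"
            using N n t eventually_sequentially by blast
        qed simp
      qed (use e in simp)
      moreover have "0 \<le> s_dist b (c n ` {0..}) (d ` {0..})"
        by (rule s_dist_bounds(1)[OF ray_unbounded[OF rays(1)] ray_unbounded[OF d]])
      ultimately show ?thesis using e by (simp add: dist_real_def)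
    qed
    then show "\<exists>N. \<forall>n\<ge>N. dist (s_dist b (c n ` {0..}) (d ` {0..})) 0 < e" by blast
  qed
  with d d0 show ?thesis by (rule that)
qed

lemma asymptotic_ray_from_in_class:
  fixes b :: "'a::complete_space"
  assumes "CAT0 TYPE('a)" "geodesic_ray c"
  shows "(c, ray_from b (asymptotic `` {c})) \<in> asymptotic"
  using ray_from_in[OF assms(1) asymptotic_class_in_boundary[OF assms(2)], of b] by simp

text \<open>
  Passing to the asymptotic ray from \<open>b\<close> does not change the class, which gives surjectivity of
  the boundary map and common starting points for sequences of ray classes.
\<close>

lemma ray_classesE_based:
  fixes b :: "'a::complete_space"
  assumes CAT0: "CAT0 TYPE('a)" and "A \<in> ray_classes b"
  obtains c where "geodesic_ray c" "c 0 = b" "A = linear_class b (c ` {0..})"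
    "\<exists>\<xi>\<in>boundary_at_infinity. c = ray_from b \<xi>"
proof -
  obtain e where e: "geodesic_ray e" "A = linear_class b (e ` {0..})"
    by (rule ray_classesE[OF assms(2)])
  define \<xi> where "\<xi> = asymptotic `` {e}"
  have \<xi>: "\<xi> \<in> boundary_at_infinity" using asymptotic_class_in_boundary[OF e(1)] by (simp add: \<xi>_def)
  have "(e, ray_from b \<xi>) \<in> asymptotic"
    unfolding \<xi>_def by (rule asymptotic_ray_from_in_class[OF CAT0 e(1)])
  from asymptotic_imp_linear_equiv[OF this, of b]
  have "A = linear_class b (ray_from b \<xi> ` {0..})"
    using equiv_class_eq[OF equiv_linear_equiv] by (simp add: e(2) linear_class_def)
  moreover have "\<exists>\<zeta>\<in>boundary_at_infinity. ray_from b \<xi> = ray_from b \<zeta>" using \<xi> by blast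
  ultimately show ?thesis by (rule that[OF ray_from_ray[OF CAT0 \<xi>] ray_from_0[OF CAT0 \<xi>]])
qed

text \<open>
  A convergent sequence of ray classes is Cauchy and has representatives starting at \<open>b\<close>. By
  \<open>Cauchy_rays_converge\<close> these converge to a ray, whose class is the limit by uniqueness of limits.
\<close>

lemma closedin_ray_classes:
  fixes b :: "'a::complete_space"
  assumes CAT0: "CAT0 TYPE('a)"
  shows "closedin (Metric_space.mtopology (linear_classes b) (class_dist b)) (ray_classes b)"
proof -
  interpret Metric_space "linear_classes b" "class_dist b" by (rule Metric_space_linear_classes)
  show ?thesis
    unfolding metric_closedin_iff_sequentially_closed
  proof (intro conjI allI impI)
    show "ray_classes b \<subseteq> linear_classes b" by (auto simp: ray_classes_def)
    fix A L assume "range A \<subseteq> ray_classes b \<and> limitin mtopology A L sequentially"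
    then have A: "range A \<subseteq> ray_classes b" and lim: "limitin mtopology A L sequentially" by auto
    have "\<exists>c. geodesic_ray c \<and> c 0 = b \<and> A n = linear_class b (c ` {0..})" for n
    proof -
      have "A n \<in> ray_classes b" using A by blast
      then obtain c where "geodesic_ray c" "c 0 = b" "A n = linear_class b (c ` {0..})"
        by (rule ray_classesE_based[OF CAT0])
      then show ?thesis by blast
    qed
    then obtain c where c: "\<And>n. geodesic_ray (c n)" "\<And>n. c n 0 = b"
      "\<And>n. A n = linear_class b (c n ` {0..})" by metis
    note unb = ray_unbounded[OF c(1)]
    have s: "s_dist b (c m ` {0..}) (c n ` {0..}) = (class_dist b (A m) (A n))\<^sup>2" for m n
      unfolding c(3) class_dist_square[OF unb unb] ..
    have Cauchy: "\<exists>N. \<forall>m\<ge>N. \<forall>n\<ge>N. s_dist b (c m ` {0..}) (c n ` {0..}) < e" if e: "e > 0" for e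
    proof -
      have "sqrt e / 2 > 0" using e by simp
      then obtain N where L: "L \<in> linear_classes b"
        and N: "\<And>n. n \<ge> N \<Longrightarrow> A n \<in> linear_classes b \<and> class_dist b (A n) L < sqrt e / 2"
        using lim unfolding limit_metric_sequentially by meson
      have "(class_dist b (A m) (A n))\<^sup>2 < e" if mn: "m \<ge> N" "n \<ge> N" for m n
      proof -
        have "class_dist b (A m) (A n) \<le> class_dist b (A m) L + class_dist b L (A n)"
          using triangle N[OF mn(1)] N[OF mn(2)] L by blast
        also have "\<dots> < sqrt e" using N[OF mn(1)] N[OF mn(2)] commute[of L "A n"] by simp
        finally have "(class_dist b (A m) (A n))\<^sup>2 < (sqrt e)\<^sup>2"
          by (intro power_strict_mono) auto
        then show ?thesis using e by simp
      qed
      then show ?thesis unfolding s by blast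
    qed
    obtain d where d: "geodesic_ray d" "d 0 = b"
      and conv: "(\<lambda>n. s_dist b (c n ` {0..}) (d ` {0..})) \<longlonglongrightarrow> 0"
      by (rule Cauchy_rays_converge[OF CAT0 c(1,2) Cauchy])
    have D: "linear_class b (d ` {0..}) \<in> ray_classes b" by (rule ray_class_in[OF d(1)])
    have "class_dist b (A n) (linear_class b (d ` {0..})) = sqrt (s_dist b (c n ` {0..}) (d ` {0..}))" for n
      unfolding c(3) class_dist_eq[OF unb ray_unbounded[OF d(1)]] t_dist_def ..
    then have "(\<lambda>n. class_dist b (A n) (linear_class b (d ` {0..}))) \<longlonglongrightarrow> 0"
      using tendsto_real_sqrt[OF conv] by simp
    moreover have "A n \<in> linear_classes b" for n using A by (auto simp: ray_classes_def)
    ultimately have "limitin mtopology A (linear_class b (d ` {0..})) sequentially"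
      unfolding limitin_metric_dist_null using D by (simp add: ray_classes_def)
    with lim have "L = linear_class b (d ` {0..})" by (rule limitin_metric_unique) simp
    with D show "L \<in> ray_classes b" by simp
  qed
qed

theorem proposition4p2:
  fixes b :: "'a::complete_space"
  assumes "CAT0 TYPE('a)"
  shows "bij_betw (\<lambda>\<xi>. linear_class b (ray_image b \<xi>)) boundary_at_infinity (ray_classes b) \<and>
         (\<forall>\<xi>\<in>boundary_at_infinity. \<forall>\<zeta>\<in>boundary_at_infinity.
            angular_dist \<xi> \<zeta> / pi
              \<le> (class_dist b (linear_class b (ray_image b \<xi>)) (linear_class b (ray_image b \<zeta>)))\<^sup>2 \<and>
            (class_dist b (linear_class b (ray_image b \<xi>)) (linear_class b (ray_image b \<zeta>)))\<^sup>2
              \<le> angular_dist \<xi> \<zeta>) \<and>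
         closedin (Metric_space.mtopology (linear_classes b) (class_dist b)) (ray_classes b)"
proof (intro conjI ballI)
  note ray = ray_from_ray[OF assms, of _ b] and start = ray_from_0[OF assms, of _ b]
  note unb = ray_unbounded[OF ray]
  show "closedin (Metric_space.mtopology (linear_classes b) (class_dist b)) (ray_classes b)"
    by (rule closedin_ray_classes[OF assms])
  show "angular_dist \<xi> \<zeta> / pi
      \<le> (class_dist b (linear_class b (ray_image b \<xi>)) (linear_class b (ray_image b \<zeta>)))\<^sup>2"
    and "(class_dist b (linear_class b (ray_image b \<xi>)) (linear_class b (ray_image b \<zeta>)))\<^sup>2
      \<le> angular_dist \<xi> \<zeta>"
    if \<xi>: "\<xi> \<in> boundary_at_infinity" and \<zeta>: "\<zeta> \<in> boundary_at_infinity" for \<xi> \<zeta>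
    unfolding ray_image_def class_dist_square[OF unb[OF \<xi>] unb[OF \<zeta>]]
      angular_dist_eq_limit_angle[OF assms \<xi> \<zeta>, of b]
    using limit_angle_le_s_dist[OF assms ray[OF \<xi>] ray[OF \<zeta>] start[OF \<xi>] start[OF \<zeta>]]
      s_dist_le_limit_angle[OF assms ray[OF \<xi>] ray[OF \<zeta>] start[OF \<xi>] start[OF \<zeta>]]
    by (simp_all add: pos_divide_le_eq mult.commute)
  show "bij_betw (\<lambda>\<xi>. linear_class b (ray_image b \<xi>)) boundary_at_infinity (ray_classes b)"
  proof (rule bij_betwI')
    fix \<xi> \<zeta> :: "(real \<Rightarrow> 'a) set"
    assume \<xi>: "\<xi> \<in> boundary_at_infinity" and \<zeta>: "\<zeta> \<in> boundary_at_infinity"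
    show "linear_class b (ray_image b \<xi>) = linear_class b (ray_image b \<zeta>) \<longleftrightarrow> \<xi> = \<zeta>"
    proof
      assume "linear_class b (ray_image b \<xi>) = linear_class b (ray_image b \<zeta>)"
      then have "s_dist b (ray_from b \<xi> ` {0..}) (ray_from b \<zeta> ` {0..}) = 0"
        unfolding ray_image_def linear_class_eq_iff[OF unb[OF \<xi>] unb[OF \<zeta>]] .
      then have "dist (ray_from b \<xi> t) (ray_from b \<zeta> t) \<le> 0" if "t \<ge> 0" for t
        using dist_rays_le_s_dist[OF assms ray[OF \<xi>] ray[OF \<zeta>] start[OF \<xi>] start[OF \<zeta>] that] by simp
      then have "ray_from b \<xi> = ray_from b \<zeta>"
        by (intro geodesic_ray_eqI[OF ray[OF \<xi>] ray[OF \<zeta>]]) auto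
      then have "ray_from b \<xi> \<in> \<xi> \<inter> \<zeta>"
        using ray_from_in[OF assms \<xi>, of b] ray_from_in[OF assms \<zeta>, of b] by simp
      then show "\<xi> = \<zeta>"
        using boundary_classD(2,3)[OF \<xi>] boundary_classD(2,3)[OF \<zeta>] by blast
    qed simp
  next
    fix \<xi> :: "(real \<Rightarrow> 'a) set" assume "\<xi> \<in> boundary_at_infinity"
    then show "linear_class b (ray_image b \<xi>) \<in> ray_classes b"
      unfolding ray_image_def by (rule ray_class_in[OF ray])
  next
    fix A assume "A \<in> ray_classes b"
    then show "\<exists>\<xi>\<in>boundary_at_infinity. A = linear_class b (ray_image b \<xi>)"
      using ray_classesE_based[OF assms] unfolding ray_image_def by metis
  qed
qed

end
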